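(* Let $X=\{X_t\}_{t\ge 0}$ be a critical CB process with branching mechanism $\psi$, where $\psi'(0+)=0$ and $\int_{\theta_0}^{+\infty}\frac{d\xi}{\psi(\xi)}<+\infty$ for some $\theta_0>0$. If for some $x>0$ the distribution functions $y\mapsto P_x\left(\bar F(t)X_t\le y\,\middle|\,\tau>t\right)$ converge weakly, as $t\to+\infty$, to a non-degenerate probability distribution function $H(y)$ on $[0,+\infty)$, then there exist $\alpha\in(0,1]$ and a function $L$ slowly varying at $+\infty$ such that $\psi(\lambda)=\lambda^{1+\alpha}L(1/\lambda)$ for all $\lambda>0$.
   Context: A (conservative) continuous-state branching process (CB process) is a $[0,+\infty)$-valued strong Markov process $X=\{X_t:t\ge 0\}$ with probabilities $\{P_x:x>0\}$ ($X$ starts at $x$ under $P_x$), with right-continuous paths having left limits, satisfying the branching property $E_{x+y}(e^{-\lambda X_t})=E_x(e^{-\lambda X_t})E_y(e^{-\lambda X_t})$ for all $\lambda,t\ge 0$, $x,y>0$. It is characterized by its branching mechanism $$\psi(\lambda)=a\lambda+b\lambda^2+\int_{(0,+\infty)}(e^{-\lambda x}-1+\lambda x)\,\Lambda(dx),\quad \lambda\ge 0,$$ with $a\in\mathbb R$, $b\ge 0$, and $\Lambda$ (the L\'evy measure of $\psi$) a non-negative measure on $(0,+\infty)$ with $\int_{(0,+\infty)}(x^2\wedge x)\Lambda(dx)<+\infty$, in the sense that $E_x(e^{-\lambda X_t})=e^{-x u_t(\lambda)}$, where $u_t(\lambda)$ is the unique positive solution of $\frac{\partial}{\partial t}u_t(\lambda)=-\psi(u_t(\lambda))$,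 $u_0(\lambda)=\lambda$. The process is called critical if $\psi'(0+)=0$. $\tau:=\inf\{t\ge 0:X_t=0\}$ is the extinction time (so $\{\tau>t\}=\{X_t>0\}$ almost surely), and $\bar F(t):=P_1(\tau>t)$. A probability distribution function is non-degenerate if it is not that of a point mass. A positive measurable function $L$ on $(0,+\infty)$ is slowly varying at $+\infty$ if $\lim_{x\to+\infty}L(\lambda x)/L(x)=1$ for all $\lambda>0$. *)

theory Defs
  imports "HOL-Probability.Probability"
begin

section \<open>Branching mechanisms\<close>

text \<open>
  A measure on \<open>(0, \<infinity>)\<close> is represented by a Borel measure on the real line
  that does not charge \<open>(-\<infinity>, 0]\<close>.
\<close>

definition cb_levy_measure :: "real measure \<Rightarrow> bool" where
  "cb_levy_measure \<Lambda> \<longleftrightarrow>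
     sets \<Lambda> = sets borel \<and> emeasure \<Lambda> {..0} = 0 \<and>
     (\<integral>\<^sup>+x\<in>{0<..}. ennreal (min (x\<^sup>2) x) \<partial>\<Lambda>) < \<infinity>"

text \<open>The values of \<open>\<psi>\<close> at negative arguments are irrelevant.\<close>

definition branching_mechanism :: "(real \<Rightarrow> real) \<Rightarrow> bool" where
  "branching_mechanism \<psi> \<longleftrightarrow>
     (\<exists>a b \<Lambda>. 0 \<le> b \<and> cb_levy_measure \<Lambda> \<and>
        (\<forall>l\<ge>0. \<psi> l = a * l + b * l\<^sup>2 + (LINT x:{0<..}|\<Lambda>. exp (- l * x) - 1 + l * x)))"

text \<open>
  \<open>u t l\<close> solves \<open>\<partial>u/\<partial>t = - \<psi>(u)\<close> with initial value \<open>l\<close>. For \<open>l = 0\<close> the only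
  nonnegative solution is \<open>0\<close>, so strict positivity is asked for \<open>l > 0\<close> only. Existence and
  uniqueness are consequences of \<open>\<psi>\<close> being a branching mechanism (it is locally Lipschitz on
  \<open>[0, \<infinity>)\<close>).
\<close>

definition cumulant :: "(real \<Rightarrow> real) \<Rightarrow> (real \<Rightarrow> real \<Rightarrow> real) \<Rightarrow> bool" where
  "cumulant \<psi> u \<longleftrightarrow>
     (\<forall>l\<ge>0. u 0 l = l \<and>
        (\<forall>t\<ge>0. 0 \<le> u t l \<and> (0 < l \<longrightarrow> 0 < u t l) \<and>
           ((\<lambda>s. u s l) has_real_derivative - \<psi> (u t l)) (at t within {0..})))"

text \<open>\<open>\<psi>'(0+) = 0\<close>, where \<open>\<psi>'(0+)\<close> is the right limit of \<open>\<psi>'\<close> at \<open>0\<close>.\<close>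

definition critical :: "(real \<Rightarrow> real) \<Rightarrow> bool" where
  "critical \<psi> \<longleftrightarrow> (deriv \<psi> \<longlongrightarrow> 0) (at_right 0)"

text \<open>
  The quotient is taken in \<^typ>\<open>ennreal\<close>, where \<open>1 / 0 = \<infinity>\<close>; with the real-valued quotient
  the condition would be satisfied by \<open>\<psi> = 0\<close>.
\<close>

definition grey_condition :: "(real \<Rightarrow> real) \<Rightarrow> bool" where
  "grey_condition \<psi> \<longleftrightarrow>
     (\<exists>\<theta>>0. (\<integral>\<^sup>+\<xi>\<in>{\<theta>..}. 1 / ennreal (\<psi> \<xi>) \<partial>lborel) < \<infinity>)"


section \<open>Continuous-state branching processes\<close>

text \<open>
  The filtration generated by \<open>X\<close>. It is indexed by \<open>[0, \<infinity>]\<close> so that stopping times may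
  take the value \<open>\<infinity>\<close>.
\<close>

definition generated_filtration ::
    "'w measure \<Rightarrow> (real \<Rightarrow> 'w \<Rightarrow> real) \<Rightarrow> ennreal \<Rightarrow> 'w measure" where
  "generated_filtration M X t =
     sigma (space M) {X s -` B \<inter> space M | s B. 0 \<le> s \<and> ennreal s \<le> t \<and> B \<in> sets borel}"

lemma filtration_generated_filtration: "filtration (space M) (generated_filtration M X)"
proof
  have sub: "{X s -` B \<inter> space M | s B. 0 \<le> s \<and> ennreal s \<le> t \<and> B \<in> sets borel} \<subseteq> Pow (space M)"
    for t by auto
  show "space (generated_filtration M X t) = space M" for t
    unfolding generated_filtration_def by (rule space_measure_of[OF sub])
  show "sets (generated_filtration M X i) \<subseteq> sets (generated_filtration M X j)"
    if "i \<le> j" for i j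
    unfolding generated_filtration_def sets_measure_of[OF sub]
    using that by (intro sigma_sets_mono') (blast intro: order_trans)
qed

text \<open>
  The probabilities \<open>P x\<close> are given for \<open>x > 0\<close> only. The transition kernel is completed by
  letting the state \<open>0\<close> be absorbing.
\<close>

definition transition_kernel ::
    "(real \<Rightarrow> 'w measure) \<Rightarrow> (real \<Rightarrow> 'w \<Rightarrow> real) \<Rightarrow> real \<Rightarrow> real \<Rightarrow> real measure" where
  "transition_kernel P X s x = (if 0 < x then distr (P x) borel (X s) else return borel 0)"

text \<open>
  The Markov property at a stopping time \<open>T\<close>: on \<open>{T < \<infinity>}\<close>, the conditional law of \<open>X (T + s)\<close>
  given the \<open>\<sigma>\<close>-algebra of events prior to \<open>T\<close> is \<open>transition_kernel P X s (X T)\<close>.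
  The stopping times are those of the filtration generated by \<open>X\<close>, without augmentation; the
  property for a larger filtration implies this one.
\<close>

definition strong_markov ::
    "'w measure \<Rightarrow> (real \<Rightarrow> 'w measure) \<Rightarrow> (real \<Rightarrow> 'w \<Rightarrow> real) \<Rightarrow> bool" where
  "strong_markov M P X \<longleftrightarrow>
     (\<forall>s\<ge>0. transition_kernel P X s \<in> restrict_space borel {0..} \<rightarrow>\<^sub>M prob_algebra borel) \<and>
     (\<forall>x>0. \<forall>T. stopping_time (generated_filtration M X) T \<longrightarrow>
        (\<forall>A \<in> sets (filtration.pre_sigma (space M) (generated_filtration M X) T).
         \<forall>s\<ge>0. \<forall>B \<in> sets borel.
           emeasure (P x) {\<omega> \<in> A. T \<omega> < \<infinity> \<and> X (enn2real (T \<omega>) + s) \<omega> \<in> B} =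
           (\<integral>\<^sup>+\<omega>\<in>{\<omega> \<in> A. T \<omega> < \<infinity>}.
              emeasure (transition_kernel P X s (X (enn2real (T \<omega>)) \<omega>)) B \<partial>P x)))"

locale cb_process =
  fixes M :: "'w measure"
    and P :: "real \<Rightarrow> 'w measure"
    and X :: "real \<Rightarrow> 'w \<Rightarrow> real"
    and \<psi> :: "real \<Rightarrow> real"
  assumes prob_space_P: "\<And>x. 0 < x \<Longrightarrow> prob_space (P x)"
    and sets_P: "\<And>x. 0 < x \<Longrightarrow> sets (P x) = sets M"
    and measurable_X: "\<And>t. 0 \<le> t \<Longrightarrow> X t \<in> borel_measurable M"
    and nonneg: "\<And>t \<omega>. 0 \<le> t \<Longrightarrow> \<omega> \<in> space M \<Longrightarrow> 0 \<le> X t \<omega>"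
    and right_continuous:
      "\<And>t \<omega>. 0 \<le> t \<Longrightarrow> \<omega> \<in> space M \<Longrightarrow> continuous (at_right t) (\<lambda>s. X s \<omega>)"
    and left_limits:
      "\<And>t \<omega>. 0 < t \<Longrightarrow> \<omega> \<in> space M \<Longrightarrow> \<exists>l. ((\<lambda>s. X s \<omega>) \<longlongrightarrow> l) (at_left t)"
    and start: "\<And>x. 0 < x \<Longrightarrow> AE \<omega> in P x. X 0 \<omega> = x"
    and strong_markov: "strong_markov M P X"
    and branching:
      "\<And>x y l t. 0 < x \<Longrightarrow> 0 < y \<Longrightarrow> 0 \<le> l \<Longrightarrow> 0 \<le> t \<Longrightarrow>
         (\<integral>\<omega>. exp (- l * X t \<omega>) \<partial>P (x + y)) =
         (\<integral>\<omega>. exp (- l * X t \<omega>) \<partial>P x) * (\<integral>\<omega>. exp (- l * X t \<omega>) \<partial>P y)"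
    and mechanism: "branching_mechanism \<psi>"
    and laplace:
      "\<exists>u. cumulant \<psi> u \<and>
         (\<forall>x>0. \<forall>t\<ge>0. \<forall>l\<ge>0. (\<integral>\<omega>. exp (- l * X t \<omega>) \<partial>P x) = exp (- x * u t l))"

definition extinction_time :: "(real \<Rightarrow> 'w \<Rightarrow> real) \<Rightarrow> 'w \<Rightarrow> ennreal" where
  "extinction_time X \<omega> = (INF t\<in>{t. 0 \<le> t \<and> X t \<omega> = 0}. ennreal t)"

text \<open>
  The event \<open>{extinction_time X > t}\<close> agrees with \<open>{X t > 0}\<close> up to a null set, but it involves
  uncountably many times and need not belong to the \<open>\<sigma>\<close>-algebra of \<open>P x\<close>. Hence \<open>P x\<close> is
  completed before it is applied to such events.
\<close>

definition survival :: "(real \<Rightarrow> 'w measure) \<Rightarrow> (real \<Rightarrow> 'w \<Rightarrow> real) \<Rightarrow> real \<Rightarrow> real" where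
  "survival P X t = \<P>(\<omega> in completion (P 1). ennreal t < extinction_time X \<omega>)"

definition conditional_df ::
    "(real \<Rightarrow> 'w measure) \<Rightarrow> (real \<Rightarrow> 'w \<Rightarrow> real) \<Rightarrow> real \<Rightarrow> real \<Rightarrow> real \<Rightarrow> real" where
  "conditional_df P X x t y =
     \<P>(\<omega> in completion (P x). survival P X t * X t \<omega> \<le> y \<bar> ennreal t < extinction_time X \<omega>)"


section \<open>Distribution functions and slow variation\<close>

definition prob_df :: "(real \<Rightarrow> real) \<Rightarrow> bool" where
  "prob_df H \<longleftrightarrow> (\<exists>\<nu>. real_distribution \<nu> \<and> H = cdf \<nu>)"

definition nondegenerate_df :: "(real \<Rightarrow> real) \<Rightarrow> bool" where
  "nondegenerate_df H \<longleftrightarrow> prob_df H \<and> (\<nexists>c. H = cdf (return borel c))"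

text \<open>Continuous-time version of \<^const>\<open>weak_conv\<close>.\<close>

definition weak_conv_at_top :: "(real \<Rightarrow> real \<Rightarrow> real) \<Rightarrow> (real \<Rightarrow> real) \<Rightarrow> bool" where
  "weak_conv_at_top F H \<longleftrightarrow> (\<forall>y. isCont H y \<longrightarrow> ((\<lambda>t. F t y) \<longlongrightarrow> H y) at_top)"

definition slowly_varying :: "(real \<Rightarrow> real) \<Rightarrow> bool" where
  "slowly_varying L \<longleftrightarrow>
     L \<in> borel_measurable (restrict_space borel {0<..}) \<and> (\<forall>x>0. 0 < L x) \<and>
     (\<forall>c>0. ((\<lambda>x. L (c * x) / L x) \<longlongrightarrow> 1) at_top)"

end

theory Submission
  imports Defs
begin

text \<open>
  Put \<open>\<Psi> z = \<integral>\<^sub>z\<^sup>\<infinity> 1/\<psi>\<close>. The equation for \<open>u\<close> becomes \<open>\<Psi> (u t l) = t + \<Psi> l\<close>, so at time \<open>t = \<Psi> z\<close> the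
  survival probability is \<open>1 - exp (- x z)\<close>, and convergence of the Laplace transforms of the
  conditional laws says that \<open>\<Psi> (g l z) / \<Psi> z - \<Psi> (l z) / \<Psi> z \<rightarrow> 1\<close> as \<open>z \<rightarrow> 0\<close>, where \<open>1 - g\<close> is the
  Laplace transform of \<open>H\<close>. Iterating \<open>g\<close> from \<open>1\<close> yields scales \<open>c\<close> for which \<open>\<Psi> (c z) / \<Psi> z\<close>
  converges to any given positive rational. By monotonicity the limit exists for every \<open>c\<close>; it is
  multiplicative in \<open>c\<close>, hence \<open>c powr - \<alpha>\<close>. Since \<open>\<psi>\<close> is monotone, regular variation passes
  from \<open>\<Psi>\<close> to \<open>\<psi> = - 1 / \<Psi>'\<close>, and \<open>\<alpha> \<le> 1\<close> because \<open>\<psi> l / l\<^sup>2\<close> decreases.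
\<close>

section \<open>Branching mechanisms\<close>

text \<open>The limit law gives only a relation between two scales, and the scales in the exact
  identities still depend on \<open>z\<close>, so they must be replaced by their limits before any
  regular variation is known. This works because \<open>\<psi>\<close> increases while
  \<open>\<psi> l / l\<^sup>2\<close> decreases: \<open>\<Psi> (k * z) / \<Psi> (c * z)\<close> then
  stays between \<open>min 1 (c / k)\<close> and \<open>max 1 (c / k)\<close> for every
  \<open>z\<close>. The same bounds keep each ratio \<open>\<Psi> (c * z) / \<Psi> z\<close> away
  from 0 and infinity and confine the exponent to [0,1]. That the exponent is not 0 has another
  source: the first iterate of \<open>g\<close> is a scale with limit ratio 2.

  On the probabilistic side, the conditioning is on the extinction time, an infimum over uncountably
  many times, while Laplace transforms see only \<open>X t\<close>. It must be shown that almost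
  surely a path that has touched 0 before \<open>t\<close> is at 0 at time \<open>t\<close>. The
  estimate behind this is a first-passage bound that depends neither on the number of observation
  times nor on the time that remains.\<close>

definition levy_kernel :: "real \<Rightarrow> real" where
  "levy_kernel s = exp (- s) - 1 + s"

lemma levy_kernel_0: "levy_kernel 0 = 0"
  by (simp add: levy_kernel_def)

lemma levy_kernel_nonneg: "0 \<le> levy_kernel s"
  using exp_ge_add_one_self[of "- s"] by (simp add: levy_kernel_def)

lemma has_real_derivative_levy_kernel:
  "(levy_kernel has_real_derivative 1 - exp (- s)) (at s)"
  unfolding levy_kernel_def by (auto intro!: derivative_eq_intros)

lemma levy_kernel_borel_measurable [measurable]: "levy_kernel \<in> borel_measurable borel"
  unfolding levy_kernel_def by measurable

lemma levy_kernel_mono: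
  assumes "0 \<le> s" "s \<le> t"
  shows "levy_kernel s \<le> levy_kernel t"
  by (rule DERIV_nonneg_imp_nondecreasing[OF assms(2)])
    (use assms has_real_derivative_levy_kernel in \<open>force intro!: exI\<close>)

text \<open>The derivative \<open>1 - exp (- r)\<close> is at most 1 and, on \<open>{0..m}\<close>,
  at most \<open>m\<close>. Keeping both bounds matches the integrability of
  \<open>min (x\<^sup>2) x\<close>, near 0 as well as at infinity.\<close>

lemma levy_kernel_diff_le:
  assumes "0 \<le> s" "0 \<le> t" "s \<le> m" "t \<le> m"
  shows "\<bar>levy_kernel s - levy_kernel t\<bar> \<le> min 1 m * \<bar>s - t\<bar>"
proof -
  have bound: "\<bar>1 - exp (- r)\<bar> \<le> min 1 m" if "r \<in> {0..m}" for r :: real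
    using that exp_ge_add_one_self[of "- r"] by (auto simp: abs_le_iff)
  have "norm (levy_kernel s - levy_kernel t) \<le> min 1 m * norm (s - t)"
    by (rule field_differentiable_bound[where S = "{0..m}" and f' = "\<lambda>r. 1 - exp (- r)"])
      (use assms bound has_real_derivative_levy_kernel in \<open>auto intro: has_field_derivative_at_within\<close>)
  then show ?thesis by simp
qed

lemma levy_kernel_le:
  assumes "0 \<le> s"
  shows "levy_kernel s \<le> min (s\<^sup>2) s"
proof -
  have "levy_kernel s \<le> min 1 s * s"
    using levy_kernel_diff_le[of s 0 s] assms by (simp add: levy_kernel_0)
  also have "\<dots> = min (s\<^sup>2) s"
    using assms by (simp add: min_mult_distrib_right power2_eq_square min.commute)
  finally show ?thesis .
qed

text \<open>\<open>k s / s\<^sup>2\<close> decreases, because \<open>s k'(s) \<le> 2 k s\<close>.\<close>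

lemma levy_kernel_scale:
  assumes "0 \<le> s" "1 \<le> c"
  shows "levy_kernel (c * s) \<le> c\<^sup>2 * levy_kernel s"
proof -
  have aux: "r * (1 - exp (- r)) \<le> 2 * levy_kernel r" if "0 \<le> r" for r :: real
  proof -
    have "2 * levy_kernel 0 - 0 * (1 - exp (- 0)) \<le> 2 * levy_kernel r - r * (1 - exp (- r))"
    proof (rule DERIV_nonneg_imp_nondecreasing[OF that])
      fix u :: real assume "0 \<le> u" "u \<le> r"
      have "exp (- u) * (1 + u) \<le> exp (- u) * exp u"
        using exp_ge_add_one_self[of u] by (intro mult_left_mono) auto
      also have "\<dots> = 1" by (simp add: exp_minus)
      finally have "0 \<le> 2 * (1 - exp (- u)) - (1 - exp (- u) + u * exp (- u))"
        by (simp add: algebra_simps)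
      moreover have "((\<lambda>r. 2 * levy_kernel r - r * (1 - exp (- r))) has_real_derivative
          2 * (1 - exp (- u)) - (1 - exp (- u) + u * exp (- u))) (at u)"
        by (auto intro!: derivative_eq_intros has_real_derivative_levy_kernel)
      ultimately show "\<exists>y. ((\<lambda>r. 2 * levy_kernel r - r * (1 - exp (- r))) has_real_derivative y)
          (at u) \<and> 0 \<le> y" by blast
    qed
    then show ?thesis by (simp add: levy_kernel_0)
  qed
  have "s\<^sup>2 * levy_kernel (c * s) \<le> s\<^sup>2 * (c\<^sup>2 * levy_kernel s)"
  proof (cases "s = 0")
    case False
    then have s: "0 < s" using assms by simp
    have "levy_kernel (c * s) / (c * s)\<^sup>2 \<le> levy_kernel s / s\<^sup>2"
    proof (rule DERIV_nonpos_imp_nonincreasing[where f = "\<lambda>r. levy_kernel r / r\<^sup>2"])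
      show "s \<le> c * s" using assms by (simp add: mult_le_cancel_right1)
      fix r assume r: "s \<le> r" "r \<le> c * s"
      then have r0: "0 < r" using s by linarith
      have "((\<lambda>r. levy_kernel r / r\<^sup>2) has_real_derivative
          ((1 - exp (- r)) * r\<^sup>2 - levy_kernel r * (2 * r)) / (r\<^sup>2 * r\<^sup>2)) (at r)"
        using r0 by (auto intro!: derivative_eq_intros has_real_derivative_levy_kernel)
      moreover have "(1 - exp (- r)) * r\<^sup>2 - levy_kernel r * (2 * r) \<le> 0"
        using mult_left_mono[OF aux[of r], of r] r0
        by (simp add: power2_eq_square algebra_simps)
      then have "((1 - exp (- r)) * r\<^sup>2 - levy_kernel r * (2 * r)) / (r\<^sup>2 * r\<^sup>2) \<le> 0"
        by (intro divide_nonpos_nonneg) simp_all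
      ultimately show "\<exists>y. ((\<lambda>r. levy_kernel r / r\<^sup>2) has_real_derivative y) (at r) \<and> y \<le> 0"
        by blast
    qed
    then show ?thesis using s assms by (simp add: field_simps power_mult_distrib)
  qed simp
  then show ?thesis
    using assms by (cases "s = 0") (auto simp: levy_kernel_0)
qed

section \<open>Integrals against the Levy measure\<close>

locale levy_integral =
  fixes N :: "real measure"
  assumes space_N: "space N = {0<..}"
    and meas: "\<And>f :: real \<Rightarrow> real. f \<in> borel_measurable borel \<Longrightarrow> f \<in> borel_measurable N"
    and int_min: "integrable N (\<lambda>x. min (x\<^sup>2) x)"

text \<open>Restricting \<open>\<Lambda>\<close> to the positive half-line turns set integrals into
  plain integrals over a space whose points are all positive, with an integrand depending on the
  product \<open>l * x\<close>.\<close>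

lemma branching_mechanism_repr:
  assumes "branching_mechanism \<psi>"
  obtains a b N where "0 \<le> b" "levy_integral N"
    "\<And>l. 0 \<le> l \<Longrightarrow> \<psi> l = a * l + b * l\<^sup>2 + (\<integral>x. levy_kernel (l * x) \<partial>N)"
proof -
  from assms obtain a b \<Lambda> where b: "0 \<le> b" and L: "cb_levy_measure \<Lambda>"
    and eq: "\<And>l. 0 \<le> l \<Longrightarrow>
      \<psi> l = a * l + b * l\<^sup>2 + (LINT x:{0<..}|\<Lambda>. exp (- l * x) - 1 + l * x)"
    unfolding branching_mechanism_def by blast
  have sets: "sets \<Lambda> = sets borel" and fin: "(\<integral>\<^sup>+x\<in>{0<..}. ennreal (min (x\<^sup>2) x) \<partial>\<Lambda>) < \<infinity>"
    using L by (auto simp: cb_levy_measure_def)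
  have space: "space \<Lambda> = UNIV" using sets_eq_imp_space_eq[OF sets] by simp
  define N where "N = restrict_space \<Lambda> {0<..}"
  have pos: "{0<..} \<inter> space \<Lambda> \<in> sets \<Lambda>" by (simp add: sets space)
  have meas: "f \<in> borel_measurable N" if "f \<in> borel_measurable borel" for f :: "real \<Rightarrow> real"
    unfolding N_def
    by (rule measurable_restrict_space1) (use that in \<open>simp cong: measurable_cong_sets add: sets\<close>)
  show ?thesis
  proof
    have "(\<integral>\<^sup>+x. ennreal (norm (min (x\<^sup>2) x)) \<partial>N) = (\<integral>\<^sup>+x\<in>{0<..}. ennreal (min (x\<^sup>2) x) \<partial>\<Lambda>)"
      unfolding N_def nn_integral_restrict_space[OF pos]
      by (intro nn_integral_cong) (auto simp: indicator_def)
    then have "integrable N (\<lambda>x. min (x\<^sup>2) x)"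
      using fin by (intro integrableI_bounded meas) auto
    moreover have "space N = {0<..}" by (simp add: N_def space_restrict_space space)
    ultimately show "levy_integral N" using meas by (intro levy_integral.intro)
    show "\<psi> l = a * l + b * l\<^sup>2 + (\<integral>x. levy_kernel (l * x) \<partial>N)" if "0 \<le> l" for l
      unfolding eq[OF that] N_def integral_restrict_space[OF pos] levy_kernel_def
      by (simp add: set_lebesgue_integral_def)
      show "0 \<le> b" by (rule b)
  qed
qed

context levy_integral
begin

lemma pos: "x \<in> space N \<Longrightarrow> 0 < x"
  by (simp add: space_N)

lemma scaled_min_le:
  fixes l x :: real
  assumes "0 \<le> l" "0 < x"
  shows "min ((l * x)\<^sup>2) (l * x) \<le> max (l\<^sup>2) l * min (x\<^sup>2) x"
proof -
  have "(l * x)\<^sup>2 \<le> max (l\<^sup>2) l * x\<^sup>2"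
    by (simp add: power_mult_distrib mult_right_mono)
  moreover have "l * x \<le> max (l\<^sup>2) l * x"
    using assms by (intro mult_right_mono) simp_all
  ultimately have "min ((l * x)\<^sup>2) (l * x) \<le> min (max (l\<^sup>2) l * x\<^sup>2) (max (l\<^sup>2) l * x)"
    by (rule min.mono)
  also have "\<dots> = max (l\<^sup>2) l * min (x\<^sup>2) x"
    using assms by (simp add: min_mult_distrib_left)
  finally show ?thesis .
qed

lemma integrable_kernel:
  assumes "0 \<le> l"
  shows "integrable N (\<lambda>x. levy_kernel (l * x))"
proof (rule Bochner_Integration.integrable_bound)
  show "integrable N (\<lambda>x. max (l\<^sup>2) l * min (x\<^sup>2) x)" using int_min by simp
  show "AE x in N. norm (levy_kernel (l * x)) \<le> norm (max (l\<^sup>2) l * min (x\<^sup>2) x)"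
  proof (intro AE_I2)
    fix x assume "x \<in> space N"
    then have x: "0 < x" by (rule pos)
    have "levy_kernel (l * x) \<le> max (l\<^sup>2) l * min (x\<^sup>2) x"
      using levy_kernel_le[of "l * x"] scaled_min_le[of l x] assms x
      by (meson mult_nonneg_nonneg less_imp_le order_trans)
    then show "norm (levy_kernel (l * x)) \<le> norm (max (l\<^sup>2) l * min (x\<^sup>2) x)"
      unfolding real_norm_def abs_of_nonneg[OF levy_kernel_nonneg] by (rule order_trans[OF _ abs_ge_self])
  qed
next
  have "(\<lambda>x. levy_kernel (l * x)) \<in> borel_measurable borel" by measurable
  then show "(\<lambda>x. levy_kernel (l * x)) \<in> borel_measurable N" by (rule meas)
qed

definition levy_int :: "real \<Rightarrow> real" where
  "levy_int l = (\<integral>x. levy_kernel (l * x) \<partial>N)"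

lemma levy_int_nonneg: "0 \<le> levy_int l"
  unfolding levy_int_def by (rule Bochner_Integration.integral_nonneg) (rule levy_kernel_nonneg)

lemma levy_int_mono:
  assumes "0 \<le> l" "l \<le> m"
  shows "levy_int l \<le> levy_int m"
  unfolding levy_int_def
proof (rule integral_mono)
  show "integrable N (\<lambda>x. levy_kernel (l * x))" "integrable N (\<lambda>x. levy_kernel (m * x))"
    using assms by (simp_all only: integrable_kernel order_trans[OF assms])
  fix x assume "x \<in> space N"
  from pos[OF this] show "levy_kernel (l * x) \<le> levy_kernel (m * x)"
    using assms by (intro levy_kernel_mono mult_right_mono mult_nonneg_nonneg) simp_all
qed

lemma levy_int_scale:
  assumes "0 \<le> l" "1 \<le> c"
  shows "levy_int (c * l) \<le> c\<^sup>2 * levy_int l"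
proof -
  have "levy_int (c * l) \<le> (\<integral>x. c\<^sup>2 * levy_kernel (l * x) \<partial>N)"
    unfolding levy_int_def
  proof (rule integral_mono)
    show "integrable N (\<lambda>x. levy_kernel (c * l * x))"
      by (rule integrable_kernel) (use assms in simp)
    show "integrable N (\<lambda>x. c\<^sup>2 * levy_kernel (l * x))"
      by (intro integrable_mult_right integrable_kernel assms)
    fix x assume "x \<in> space N"
    from pos[OF this] show "levy_kernel (c * l * x) \<le> c\<^sup>2 * levy_kernel (l * x)"
      unfolding mult.assoc using assms by (intro levy_kernel_scale) simp_all
  qed
  then show ?thesis by (simp add: levy_int_def)
qed

text \<open>Differentiation under the integral sign. Since \<open>critical\<close> speaks of
  \<open>deriv\<close>, an actual derivative is needed to read off the linear coefficient of
  \<open>\<psi>\<close>.\<close>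

lemma DERIV_levy_int:
  assumes l: "0 < l"
  shows "(levy_int has_real_derivative (\<integral>x. x * (1 - exp (- (l * x))) \<partial>N)) (at l)"
  unfolding DERIV_def tendsto_at_iff_sequentially
proof (intro allI impI)
  fix h :: "nat \<Rightarrow> real" assume h0: "\<forall>i. h i \<in> UNIV - {0}" and h: "h \<longlonglongrightarrow> 0"
  \<comment> \<open>Once \<open>\<bar>h i\<bar> < l\<close>, both arguments of the kernel lie in
    \<open>{0..2 * l * x}\<close>. The Lipschitz bound then gives
    \<open>min 1 (2 * l * x) * x\<close> for the difference quotient, whence the dominating function
    below.\<close>
  have "eventually (\<lambda>i. \<bar>h i\<bar> < l) sequentially"
    using order_tendstoD(2)[OF tendsto_rabs[OF h], of l] l by simp
  then obtain m where m: "\<And>i. m \<le> i \<Longrightarrow> \<bar>h i\<bar> < l"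
    by (auto simp: eventually_sequentially)
  define q where "q i x = (levy_kernel ((l + h i) * x) - levy_kernel (l * x)) / h i" for i x
  have "(\<lambda>i. \<integral>x. q (i + m) x \<partial>N) \<longlonglongrightarrow> (\<integral>x. x * (1 - exp (- (l * x))) \<partial>N)"
  proof (rule integral_dominated_convergence[where w = "\<lambda>x. max 1 (2 * l) * min (x\<^sup>2) x"])
    show "integrable N (\<lambda>x. max 1 (2 * l) * min (x\<^sup>2) x)" using int_min by simp
    show "AE x in N. norm (q (i + m) x) \<le> max 1 (2 * l) * min (x\<^sup>2) x" for i
    proof (intro AE_I2)
      fix x assume "x \<in> space N"
      then have x: "0 < x" by (rule pos)
      define d where "d = h (i + m)"
      have d: "\<bar>d\<bar> < l" "d \<noteq> 0" using m[of "i + m"] h0 by (auto simp: d_def)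
      have "\<bar>levy_kernel ((l + d) * x) - levy_kernel (l * x)\<bar>
          \<le> min 1 (2 * l * x) * \<bar>(l + d) * x - l * x\<bar>"
        using l d x by (intro levy_kernel_diff_le) auto
      also have "\<dots> = \<bar>d\<bar> * (min 1 (2 * l * x) * x)"
        using x by (simp add: abs_mult algebra_simps)
      finally have "norm (q (i + m) x) \<le> min 1 (2 * l * x) * x"
        using d by (simp add: q_def d_def divide_simps abs_mult mult.commute)
      also have "\<dots> = min x (2 * l * x\<^sup>2)"
        using x l by (auto simp: min_def power2_eq_square)
      also have "\<dots> \<le> max 1 (2 * l) * min (x\<^sup>2) x"
      proof (cases "x\<^sup>2 \<le> x")
        case True
        have "2 * l * x\<^sup>2 \<le> max 1 (2 * l) * x\<^sup>2" by (intro mult_right_mono) auto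
        then show ?thesis using True by (auto simp: min_def split: if_splits)
      next
        case False
        have "1 * x \<le> max 1 (2 * l) * x" using x by (intro mult_right_mono) auto
        then show ?thesis using False by (auto simp: min_def)
      qed
      finally show "norm (q (i + m) x) \<le> max 1 (2 * l) * min (x\<^sup>2) x" .
    qed
    show "AE x in N. (\<lambda>i. q (i + m) x) \<longlonglongrightarrow> x * (1 - exp (- (l * x)))"
    proof (intro AE_I2 LIMSEQ_ignore_initial_segment)
      fix x
      have "((\<lambda>r. levy_kernel (r * x)) has_real_derivative x * (1 - exp (- (l * x)))) (at l)"
        by (rule DERIV_chain'[OF _ has_real_derivative_levy_kernel, THEN DERIV_cong])
          (auto intro!: derivative_eq_intros)
      then have "((\<lambda>d. (levy_kernel ((l + d) * x) - levy_kernel (l * x)) / d)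
          \<longlongrightarrow> x * (1 - exp (- (l * x)))) (at 0)"
        by (simp add: DERIV_def)
      then show "(\<lambda>i. q i x) \<longlonglongrightarrow> x * (1 - exp (- (l * x)))"
        using h0 h unfolding tendsto_at_iff_sequentially q_def by (auto simp: o_def)
    qed
    show "q (i + m) \<in> borel_measurable N" for i
      unfolding q_def by (intro meas) measurable
    show "(\<lambda>x. x * (1 - exp (- (l * x)))) \<in> borel_measurable N"
      by (intro meas) measurable
  qed
  moreover have "(\<integral>x. q (i + m) x \<partial>N) = (levy_int (l + h (i + m)) - levy_int l) / h (i + m)" for i
    using m[of "i + m"] l unfolding q_def levy_int_def
    by (simp add: integrable_kernel Bochner_Integration.integral_diff)
  ultimately have "(\<lambda>i. (levy_int (l + h (i + m)) - levy_int l) / h (i + m))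
      \<longlonglongrightarrow> (\<integral>x. x * (1 - exp (- (l * x))) \<partial>N)" by simp
  from LIMSEQ_offset[OF this]
  show "((\<lambda>h. (levy_int (l + h) - levy_int l) / h) \<circ> h) \<longlonglongrightarrow> (\<integral>x. x * (1 - exp (- (l * x))) \<partial>N)"
    by (simp add: o_def)
qed

text \<open>This leaves the linear coefficient \<open>a\<close> as the limit of
  \<open>deriv \<psi>\<close> at 0. For \<open>h n \<le> 1\<close>, the factor
  \<open>1 - exp (- (h n * x))\<close> is at most \<open>min x 1\<close>, which gives the integrable
  bound.\<close>

lemma levy_int_deriv_tendsto_0:
  assumes h: "h \<longlonglongrightarrow> 0" "\<And>n. 0 < h n" "\<And>n. h n \<le> (1 :: real)"
  shows "(\<lambda>n. \<integral>x. x * (1 - exp (- (h n * x))) \<partial>N) \<longlonglongrightarrow> 0"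
proof -
  define q where "q n x = x * (1 - exp (- (h n * x)))" for n x
  have "(\<lambda>n. \<integral>x. q n x \<partial>N) \<longlonglongrightarrow> (\<integral>x. 0 \<partial>N)"
  proof (rule integral_dominated_convergence[where w = "\<lambda>x. min (x\<^sup>2) x"])
    show "AE x in N. norm (q n x) \<le> min (x\<^sup>2) x" for n
    proof (intro AE_I2)
      fix x assume "x \<in> space N"
      then have x: "0 < x" by (rule pos)
      have hx: "0 \<le> h n * x" using h(2)[of n] x by simp
      have "h n * x \<le> 1 * x" using x h by (intro mult_right_mono) auto
      then have "1 - exp (- (h n * x)) \<le> x" using exp_ge_add_one_self[of "- (h n * x)"] by simp
      moreover have "1 - exp (- (h n * x)) \<le> 1" by simp
      ultimately have "x * (1 - exp (- (h n * x))) \<le> x * min x 1"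
        using x by (intro mult_left_mono) auto
      also have "\<dots> = min (x\<^sup>2) x" using x by (simp add: min_mult_distrib_left power2_eq_square)
      finally show "norm (q n x) \<le> min (x\<^sup>2) x" using x hx by (simp add: q_def)
    qed
    show "AE x in N. (\<lambda>n. q n x) \<longlonglongrightarrow> 0"
    proof (intro AE_I2)
      fix x
      have "(\<lambda>n. q n x) \<longlonglongrightarrow> x * (1 - exp (- (0 * x)))"
        unfolding q_def by (intro tendsto_intros h)
      then show "(\<lambda>n. q n x) \<longlonglongrightarrow> 0" by simp
    qed
    show "q n \<in> borel_measurable N" for n
      unfolding q_def by (intro meas) measurable
  qed (use int_min in simp_all)
  then show ?thesis by (simp add: q_def)
qed

end

section \<open>Monotonicity, positivity and quadratic scaling of the mechanism\<close>

locale mechanism_shape =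
  fixes \<psi> :: "real \<Rightarrow> real"
  assumes psi_nonneg: "\<And>l. 0 \<le> l \<Longrightarrow> 0 \<le> \<psi> l"
    and psi_pos: "\<And>l. 0 < l \<Longrightarrow> 0 < \<psi> l"
    and psi_mono: "\<And>l m. 0 < l \<Longrightarrow> l \<le> m \<Longrightarrow> \<psi> l \<le> \<psi> m"
    and psi_scale: "\<And>l c. 0 < l \<Longrightarrow> 1 \<le> c \<Longrightarrow> \<psi> (c * l) \<le> c\<^sup>2 * \<psi> l"

text \<open>Criticality removes the linear term; the quadratic term and the integral are
  nonnegative, increasing and scale at most quadratically. Strict positivity comes from Grey's
  condition.\<close>

lemma branching_mechanism_shape:
  assumes "branching_mechanism \<psi>" "critical \<psi>" "grey_condition \<psi>"
  shows "mechanism_shape \<psi>"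
proof -
  obtain a b N where b: "0 \<le> b" and "levy_integral N"
    and eq: "\<And>l. 0 \<le> l \<Longrightarrow> \<psi> l = a * l + b * l\<^sup>2 + (\<integral>x. levy_kernel (l * x) \<partial>N)"
    by (rule branching_mechanism_repr[OF assms(1)]) blast
  interpret levy_integral N by fact
  have eq: "\<psi> l = a * l + b * l\<^sup>2 + levy_int l" if "0 \<le> l" for l
    using eq[OF that] by (simp add: levy_int_def)
  define h where "h n = inverse (real (Suc n))" for n
  have h: "h \<longlonglongrightarrow> 0" "\<And>n. 0 < h n" "\<And>n. h n \<le> 1"
    unfolding h_def by (rule LIMSEQ_inverse_real_of_nat) (simp_all add: divide_simps)
  have "deriv \<psi> l = a + 2 * b * l + (\<integral>x. x * (1 - exp (- (l * x))) \<partial>N)" if l: "0 < l" for l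
  proof (rule DERIV_imp_deriv)
    have "((\<lambda>l. a * l + b * l\<^sup>2 + levy_int l) has_real_derivative
        a + 2 * b * l + (\<integral>x. x * (1 - exp (- (l * x))) \<partial>N)) (at l)"
      by (auto intro!: derivative_eq_intros DERIV_levy_int l)
    then show "(\<psi> has_real_derivative
        a + 2 * b * l + (\<integral>x. x * (1 - exp (- (l * x))) \<partial>N)) (at l)"
      by (rule has_field_derivative_transform_within_open[where S = "{0<..}"])
        (use l eq in auto)
  qed
  then have "(\<lambda>n. deriv \<psi> (h n)) = (\<lambda>n. a + 2 * b * h n + (\<integral>x. x * (1 - exp (- (h n * x))) \<partial>N))"
    using h by simp
  moreover have "\<dots> \<longlonglongrightarrow> a + 2 * b * 0 + 0"
    by (intro tendsto_intros levy_int_deriv_tendsto_0 h)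
  moreover have "filterlim h (at_right 0) sequentially"
    by (rule filterlim_at_withinI[OF h(1)]) (use h(2) less_imp_neq in \<open>auto intro!: always_eventually\<close>)
  then have "(\<lambda>n. deriv \<psi> (h n)) \<longlonglongrightarrow> 0"
    by (rule filterlim_compose[OF assms(2)[unfolded critical_def]])
  ultimately have a: "a = 0" using LIMSEQ_unique by fastforce
  have nonneg: "0 \<le> \<psi> l" if "0 \<le> l" for l
    using that b levy_int_nonneg[of l] by (simp add: eq a)
  have scale: "\<psi> (c * l) \<le> c\<^sup>2 * \<psi> l" if "0 < l" "1 \<le> c" for l c
    using that levy_int_scale[of l c] by (simp add: eq a algebra_simps power_mult_distrib)
  have mono: "\<psi> l \<le> \<psi> m" if "0 < l" "l \<le> m" for l m
    using that levy_int_mono[of l m] b by (auto simp: eq a intro!: add_mono mult_left_mono power_mono)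
  have pos: "0 < \<psi> l" if l: "0 < l" for l
  proof (rule ccontr)
    assume "\<not> 0 < \<psi> l"
    then have l0: "\<psi> l = 0" using nonneg[of l] l by simp
    \<comment> \<open>Quadratic scaling propagates a zero at \<open>l\<close> to all larger
      arguments. There \<open>1 / ennreal 0 = \<infinity>\<close>, so Grey's integral would diverge
      from every starting point.\<close>
    have zero: "\<psi> m = 0" if "l \<le> m" for m
      using scale[of l "m / l"] nonneg[of m] that l l0 by (auto simp: divide_simps)
    obtain \<theta> where \<theta>: "0 < \<theta>" "(\<integral>\<^sup>+\<xi>\<in>{\<theta>..}. 1 / ennreal (\<psi> \<xi>) \<partial>lborel) < \<infinity>"
      using assms(3) unfolding grey_condition_def by blast
    let ?m = "max \<theta> l"
    have "(\<integral>\<^sup>+\<xi>. \<infinity> * indicator {?m..?m + 1} \<xi> \<partial>lborel)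
        \<le> (\<integral>\<^sup>+\<xi>\<in>{\<theta>..}. 1 / ennreal (\<psi> \<xi>) \<partial>lborel)"
      by (intro nn_integral_mono) (auto simp: indicator_def zero)
    also have "(\<integral>\<^sup>+\<xi>. \<infinity> * indicator {?m..?m + 1} \<xi> \<partial>lborel) = \<infinity>"
      by (subst nn_integral_cmult_indicator) auto
    finally show False using \<theta>(2) by simp
  qed
  show ?thesis by unfold_locales (use nonneg pos mono scale in auto)
qed

context mechanism_shape
begin

text \<open>Monotonicity and quadratic scaling squeeze \<open>\<psi> m\<close> between multiples of
  \<open>\<psi> l\<close> whose factors tend to 1 as \<open>m\<close> approaches
  \<open>l\<close>.\<close>

lemma psi_continuous_on: "continuous_on {0<..} \<psi>"
proof (rule continuous_at_imp_continuous_on, rule ballI)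
  fix l :: real assume "l \<in> {0<..}"
  then have l: "0 < l" by simp
  have bounds: "min 1 ((m / l)\<^sup>2) * \<psi> l \<le> \<psi> m \<and> \<psi> m \<le> max 1 ((m / l)\<^sup>2) * \<psi> l" if m: "0 < m" for m
  proof (cases "l \<le> m")
    case True
    then have "1 \<le> (m / l)\<^sup>2" using l by (intro one_le_power) simp
    then show ?thesis
      using psi_mono[of l m] psi_scale[of l "m / l"] True l by simp
  next
    case False
    have "\<psi> l \<le> (l / m)\<^sup>2 * \<psi> m" using psi_scale[of m "l / m"] False m l by simp
    then have "(m / l)\<^sup>2 * \<psi> l \<le> \<psi> m"
      using m l by (simp add: field_simps)
    moreover have "(m / l)\<^sup>2 \<le> 1" using False m l by (intro power_le_one) auto
    ultimately show ?thesis using psi_mono[of m l] m False by simp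
  qed
  have ev: "eventually (\<lambda>m. 0 < m) (at l)"
    using l by (rule order_tendstoD(1)[OF tendsto_ident_at])
  show "isCont \<psi> l"
    unfolding isCont_def
  proof (rule tendsto_sandwich)
    show "eventually (\<lambda>m. min 1 ((m / l)\<^sup>2) * \<psi> l \<le> \<psi> m) (at l)"
      using ev by eventually_elim (use bounds in blast)
    show "eventually (\<lambda>m. \<psi> m \<le> max 1 ((m / l)\<^sup>2) * \<psi> l) (at l)"
      using ev by eventually_elim (use bounds in blast)
    have "((\<lambda>m. min 1 ((m / l)\<^sup>2) * \<psi> l) \<longlongrightarrow> min 1 ((l / l)\<^sup>2) * \<psi> l) (at l)"
      using l by (intro tendsto_intros) simp
    then show "((\<lambda>m. min 1 ((m / l)\<^sup>2) * \<psi> l) \<longlongrightarrow> \<psi> l) (at l)" using l by simp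
    have "((\<lambda>m. max 1 ((m / l)\<^sup>2) * \<psi> l) \<longlongrightarrow> max 1 ((l / l)\<^sup>2) * \<psi> l) (at l)"
      using l by (intro tendsto_intros) simp
    then show "((\<lambda>m. max 1 ((m / l)\<^sup>2) * \<psi> l) \<longlongrightarrow> \<psi> l) (at l)" using l by simp
  qed
qed

end

section \<open>The tail integral of the reciprocal mechanism\<close>

text \<open>\<open>\<Psi> z\<close> is the integral of \<open>1 / \<psi>\<close> over \<open>[z, \<infinity>)\<close>, characterised as an antiderivative.\<close>

locale grey_function = mechanism_shape +
  fixes \<Psi> :: "real \<Rightarrow> real"
  assumes DERIV_Psi: "\<And>z. 0 < z \<Longrightarrow> (\<Psi> has_real_derivative - 1 / \<psi> z) (at z)"
    and Psi_at_top: "(\<Psi> \<longlongrightarrow> 0) at_top"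

text \<open>An antiderivative \<open>F\<close> of \<open>1 / \<psi>\<close> increases and is bounded
  by means of Grey's integral, so it has a limit \<open>S\<close> at infinity; \<open>S - F\<close>
  has the required properties.\<close>

lemma (in mechanism_shape) grey_function_exists:
  assumes "grey_condition \<psi>"
  obtains \<Psi> where "grey_function \<psi> \<Psi>"
proof -
  have cont: "isCont \<psi> z" if "0 < z" for z
    using psi_continuous_on that by (simp add: continuous_on_eq_continuous_at)
  have "\<exists>F. \<forall>z. 0 < ereal z \<longrightarrow> ereal z < \<infinity> \<longrightarrow> (F has_vector_derivative 1 / \<psi> z) (at z)"
  proof (rule einterval_antiderivative)
    fix z assume "0 < ereal z"
    then have "0 < z" by simp
    then show "isCont (\<lambda>z. 1 / \<psi> z) z"
      using psi_pos[of z] by (intro continuous_intros cont) auto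
  qed simp
  then obtain F where F: "\<And>z. 0 < z \<Longrightarrow> (F has_real_derivative 1 / \<psi> z) (at z)"
    by (auto simp: has_real_derivative_iff_has_vector_derivative)
  have F_mono: "F z \<le> F w" if "0 < z" "z \<le> w" for z w
  proof (rule DERIV_nonneg_imp_nondecreasing[OF that(2)])
    fix u assume "z \<le> u"
    then have "0 < u" using that by simp
    then show "\<exists>y. (F has_real_derivative y) (at u) \<and> 0 \<le> y"
      using F[of u] psi_pos[of u] by (intro exI[of _ "1 / \<psi> u"]) simp
  qed
  obtain \<theta> where \<theta>: "0 < \<theta>" and fin: "(\<integral>\<^sup>+\<xi>\<in>{\<theta>..}. 1 / ennreal (\<psi> \<xi>) \<partial>lborel) < \<infinity>"
    using assms unfolding grey_condition_def by blast
  define J where "J = enn2real (\<integral>\<^sup>+\<xi>\<in>{\<theta>..}. 1 / ennreal (\<psi> \<xi>) \<partial>lborel)"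
  \<comment> \<open>Nothing is known of \<open>\<psi>\<close> at negative arguments, so
    \<open>1 / \<psi>\<close> is cut off there to obtain a Borel function.\<close>
  define f where "f \<xi> = indicator {0<..} \<xi> *\<^sub>R (1 / \<psi> \<xi>)" for \<xi> :: real
  have f_borel: "f \<in> borel_measurable borel"
    unfolding f_def
    by (intro borel_measurable_continuous_on_indicator continuous_intros psi_continuous_on)
      (use psi_pos in force)+
  have F_bound: "F w \<le> F \<theta> + J" if "\<theta> \<le> w" for w
  proof -
    have "ennreal (F w - F \<theta>) = (\<integral>\<^sup>+\<xi>. ennreal (f \<xi>) * indicator {\<theta>..w} \<xi> \<partial>lborel)"
      using \<theta> that psi_nonneg F
      by (intro nn_integral_FTC_Icc[symmetric] f_borel) (auto simp: f_def)
    also have "\<dots> \<le> (\<integral>\<^sup>+\<xi>\<in>{\<theta>..}. 1 / ennreal (\<psi> \<xi>) \<partial>lborel)"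
      using \<theta> psi_pos
      by (intro nn_integral_mono) (auto simp: f_def indicator_def divide_ennreal[of 1, simplified])
    also have "\<dots> = ennreal J" using fin by (simp add: J_def)
    finally show ?thesis by (simp add: J_def ennreal_le_iff)
  qed
  define S where "S = (SUP w\<in>{\<theta>..}. F w)"
  have bdd: "bdd_above (F ` {\<theta>..})" using F_bound by (intro bdd_aboveI) auto
  have lim: "(F \<longlongrightarrow> S) at_top"
  proof (rule order_tendstoI)
    fix y assume "y < S"
    then obtain w where w: "\<theta> \<le> w" "y < F w"
      unfolding S_def using less_cSUP_iff[OF _ bdd] by auto
    show "eventually (\<lambda>x. y < F x) at_top"
      using eventually_ge_at_top[of w] by eventually_elim (use w \<theta> F_mono[of w] in force)
  next
    fix y assume y: "S < y"
    show "eventually (\<lambda>x. F x < y) at_top"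
      using eventually_ge_at_top[of \<theta>]
    proof eventually_elim
      case (elim x)
      then have "F x \<le> S" unfolding S_def by (intro cSUP_upper bdd) simp
      then show ?case using y by simp
    qed
  qed
  have "grey_function \<psi> (\<lambda>z. S - F z)"
  proof
    show "((\<lambda>z. S - F z) has_real_derivative - 1 / \<psi> z) (at z)" if "0 < z" for z
      using F[OF that] by (auto intro!: derivative_eq_intros)
    have "((\<lambda>z. S - F z) \<longlongrightarrow> S - S) at_top" by (intro tendsto_intros lim)
    then show "((\<lambda>z. S - F z) \<longlongrightarrow> 0) at_top" by simp
  qed
  then show ?thesis by (rule that)
qed

context grey_function
begin

lemma Psi_strict_antimono:
  assumes "0 < z" "z < w"
  shows "\<Psi> w < \<Psi> z"
proof (rule DERIV_neg_imp_decreasing[OF assms(2)])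
  fix u assume "z \<le> u"
  then have "0 < u" using assms by simp
  then show "\<exists>y. (\<Psi> has_real_derivative y) (at u) \<and> y < 0"
    using DERIV_Psi[of u] psi_pos[of u] by (intro exI[of _ "- 1 / \<psi> u"]) simp
qed

lemma Psi_antimono:
  assumes "0 < z" "z \<le> w"
  shows "\<Psi> w \<le> \<Psi> z"
  using Psi_strict_antimono[of z w] assms by (cases "z = w") auto

lemma Psi_less_iff: "0 < z \<Longrightarrow> 0 < w \<Longrightarrow> \<Psi> w < \<Psi> z \<longleftrightarrow> z < w"
  using Psi_strict_antimono Psi_antimono by (meson not_less)

lemma Psi_pos:
  assumes "0 < z"
  shows "0 < \<Psi> z"
proof -
  have "0 \<le> \<Psi> (z + 1)"
    using Psi_at_top by (rule tendsto_upperbound)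
      (use assms Psi_antimono in \<open>auto intro!: eventually_at_top_linorderI[of "z + 1"]\<close>)
  then show ?thesis using Psi_strict_antimono[of z "z + 1"] assms by simp
qed

text \<open>The difference of the two sides decreases to \<open>0\<close> at infinity, because \<open>\<psi> (c z) \<le> c\<^sup>2 \<psi> z\<close>.\<close>

lemma Psi_scale:
  assumes z: "0 < z" and c: "1 \<le> c"
  shows "\<Psi> z \<le> c * \<Psi> (c * z)"
proof -
  define D where "D z = c * \<Psi> (c * z) - \<Psi> z" for z
  have dec: "D w \<le> D z" if "z \<le> w" for w
  proof (rule DERIV_nonpos_imp_nonincreasing[OF that])
    fix u assume "z \<le> u"
    then have u: "0 < u" using z by simp
    have "(D has_real_derivative c * (- 1 / \<psi> (c * u) * c) - (- 1 / \<psi> u)) (at u)"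
      unfolding D_def
      by (intro DERIV_diff DERIV_Psi u DERIV_cmult DERIV_chain2[where g = "\<lambda>z. c * z"])
        (use u c in \<open>auto intro!: derivative_eq_intros\<close>)
    moreover have "c * (- 1 / \<psi> (c * u) * c) - (- 1 / \<psi> u) \<le> 0"
      using psi_scale[of u c] psi_pos[of u] psi_pos[of "c * u"] u c
      by (simp add: divide_simps power2_eq_square mult.commute)
    ultimately show "\<exists>y. (D has_real_derivative y) (at u) \<and> y \<le> 0" by blast
  qed
  have "filterlim (\<lambda>w. c * w) at_top at_top"
    using c by (intro filterlim_tendsto_pos_mult_at_top[of _ c] filterlim_ident) auto
  then have "(D \<longlongrightarrow> c * 0 - 0) at_top"
    unfolding D_def
    by (intro tendsto_intros Psi_at_top filterlim_compose[OF Psi_at_top])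
  then have "c * 0 - 0 \<le> D z"
    by (rule tendsto_upperbound) (use dec in \<open>auto intro!: eventually_at_top_linorderI\<close>)
  then show ?thesis by (simp add: D_def)
qed

end

section \<open>Regular variation\<close>

text \<open>The deviation \<open>h\<close> from linearity is additive and vanishes on the integers,
  so it has period 1 and is bounded. Multiples of a nonzero value would be unbounded.\<close>

lemma additive_bounded_imp_linear:
  fixes f :: "real \<Rightarrow> real"
  assumes add: "\<And>s t. f (s + t) = f s + f t"
    and bound: "\<And>s. 0 \<le> s \<Longrightarrow> \<bar>f s\<bar> \<le> s"
  shows "f s = s * f 1"
proof -
  define h where "h s = f s - s * f 1" for s
  have h_add: "h (s + t) = h s + h t" for s t
    by (simp add: h_def add algebra_simps)
  have h0: "h 0 = 0" using h_add[of 0 0] by simp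
  have h_minus: "h (- s) = - h s" for s using h_add[of s "- s"] h0 by simp
  have h_nat: "h (real n * s) = real n * h s" for n s
    by (induction n) (simp_all add: h0 h_add algebra_simps)
  have h_of_nat: "h (real n) = 0" for n using h_nat[of n 1] by (simp add: h_def)
  have h_int: "h (of_int k) = 0" for k
    by (cases k) (simp_all add: h_of_nat h_minus del: of_nat_Suc)
  have h_bound: "\<bar>h s\<bar> \<le> 2" for s
  proof -
    have "h s = h (frac s)" using h_add[of "frac s" "of_int \<lfloor>s\<rfloor>"] h_int by (simp add: frac_def)
    moreover have "0 \<le> frac s" "frac s < 1" using frac_lt_1[of s] by simp_all
    moreover from this have "\<bar>f (frac s)\<bar> \<le> 1" using bound[of "frac s"] by simp
    moreover have "\<bar>f 1\<bar> \<le> 1" using bound[of 1] by simp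
    then have "\<bar>frac s * f 1\<bar> \<le> 1"
      using \<open>0 \<le> frac s\<close> \<open>frac s < 1\<close> by (simp add: abs_mult mult_le_one)
    ultimately show ?thesis by (simp add: h_def[of "frac s"])
  qed
  have "h s = 0"
  proof (rule ccontr)
    assume "h s \<noteq> 0"
    then obtain n :: nat where "2 < real n * \<bar>h s\<bar>"
      using reals_Archimedean3[of "\<bar>h s\<bar>"] by auto
    then show False using h_bound[of "real n * s"] by (simp add: h_nat abs_mult)
  qed
  then show ?thesis by (simp add: h_def)
qed

lemma filterlim_mult_at_right_0:
  fixes c :: real
  assumes "0 < c"
  shows "filterlim (\<lambda>z. c * z) (at_right 0) (at_right 0)"
proof (rule filterlim_at_withinI)
  have "((\<lambda>z. c * z) \<longlongrightarrow> c * 0) (at_right 0)" by (intro tendsto_intros)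
  then show "((\<lambda>z. c * z) \<longlongrightarrow> 0) (at_right 0)" by simp
  show "eventually (\<lambda>z. c * z \<in> {0<..} - {0}) (at_right 0)"
    using eventually_at_right_less[of 0] by eventually_elim (use assms in simp)
qed

section \<open>Ratios of \<open>\<Psi>\<close> at two scales\<close>

context grey_function
begin

definition F :: "real \<Rightarrow> real \<Rightarrow> real" where
  "F c z = \<Psi> (c * z) / \<Psi> z"

lemma F_pos: "0 < c \<Longrightarrow> 0 < z \<Longrightarrow> 0 < F c z"
  by (simp add: F_def Psi_pos)

lemma F_antimono:
  assumes "0 < c" "c \<le> d" "0 < z"
  shows "F d z \<le> F c z"
  unfolding F_def using assms
  by (intro divide_right_mono Psi_antimono mult_right_mono less_imp_le[OF Psi_pos]) simp_all

text \<open>Monotonicity supplies the bound 1 and \<open>Psi_scale\<close> the bound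
  \<open>c / k\<close>; the order of \<open>c\<close> and \<open>k\<close> decides which is the
  upper and which the lower one.\<close>

lemma Psi_quotient_bounds:
  assumes "0 < c" "0 < k" "0 < z"
  shows "min 1 (c / k) \<le> \<Psi> (k * z) / \<Psi> (c * z)" "\<Psi> (k * z) / \<Psi> (c * z) \<le> max 1 (c / k)"
proof -
  have pos: "0 < \<Psi> (c * z)" "0 < \<Psi> (k * z)" using assms by (auto intro: Psi_pos)
  have "min 1 (c / k) \<le> \<Psi> (k * z) / \<Psi> (c * z) \<and> \<Psi> (k * z) / \<Psi> (c * z) \<le> max 1 (c / k)"
  proof (cases "c \<le> k")
    case True
    have "\<Psi> (k * z) \<le> \<Psi> (c * z)" using assms True by (intro Psi_antimono mult_right_mono) auto
    moreover have "\<Psi> (c * z) \<le> k / c * \<Psi> (k / c * (c * z))"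
      using assms True by (intro Psi_scale) auto
    then have "c / k \<le> \<Psi> (k * z) / \<Psi> (c * z)" using assms pos by (simp add: field_simps)
    ultimately show ?thesis using pos by (simp add: min.coboundedI2 max.coboundedI1)
  next
    case False
    have "\<Psi> (c * z) \<le> \<Psi> (k * z)" using assms False by (intro Psi_antimono mult_right_mono) auto
    moreover have "\<Psi> (k * z) \<le> c / k * \<Psi> (c / k * (k * z))"
      using assms False by (intro Psi_scale) auto
    then have "\<Psi> (k * z) / \<Psi> (c * z) \<le> c / k" using assms pos by (simp add: field_simps)
    ultimately show ?thesis using pos by (simp add: min.coboundedI1 max.coboundedI2)
  qed
  then show "min 1 (c / k) \<le> \<Psi> (k * z) / \<Psi> (c * z)" "\<Psi> (k * z) / \<Psi> (c * z) \<le> max 1 (c / k)"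
    by simp_all
qed

lemma F_bounds:
  assumes "0 < c" "0 < z"
  shows "min 1 (1 / c) \<le> F c z" "F c z \<le> max 1 (1 / c)"
  using Psi_quotient_bounds[of 1 c z] assms by (simp_all add: F_def)

text \<open>Both bounds on the quotient tend to 1 when \<open>k z\<close> tends to \<open>c\<close>.
  This takes the place of the uniform convergence theorem, which would presuppose regular
  variation.\<close>

lemma Psi_asymp_equiv:
  assumes c: "0 < c" and k: "(k \<longlongrightarrow> c) (at_right 0)"
  shows "((\<lambda>z. \<Psi> (k z * z) / \<Psi> (c * z)) \<longlongrightarrow> 1) (at_right 0)"
proof (rule tendsto_sandwich)
  have ev: "eventually (\<lambda>z. 0 < k z \<and> 0 < z) (at_right 0)"
    using order_tendstoD(1)[OF k c] eventually_at_right_less[of 0] by eventually_elim simp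
  show "eventually (\<lambda>z. min 1 (c / k z) \<le> \<Psi> (k z * z) / \<Psi> (c * z)) (at_right 0)"
    using ev by eventually_elim (intro Psi_quotient_bounds(1) c; simp)
  show "eventually (\<lambda>z. \<Psi> (k z * z) / \<Psi> (c * z) \<le> max 1 (c / k z)) (at_right 0)"
    using ev by eventually_elim (intro Psi_quotient_bounds(2) c; simp)
  have "((\<lambda>z. min 1 (c / k z)) \<longlongrightarrow> min 1 (c / c)) (at_right 0)"
    using c by (intro tendsto_intros k) simp
  then show "((\<lambda>z. min 1 (c / k z)) \<longlongrightarrow> 1) (at_right 0)" using c by simp
  have "((\<lambda>z. max 1 (c / k z)) \<longlongrightarrow> max 1 (c / c)) (at_right 0)"
    using c by (intro tendsto_intros k) simp
  then show "((\<lambda>z. max 1 (c / k z)) \<longlongrightarrow> 1) (at_right 0)" using c by simp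
qed

lemma F_mult: "0 < c \<Longrightarrow> 0 < d \<Longrightarrow> 0 < z \<Longrightarrow> F (c * d) z = F c (d * z) * F d z"
  using Psi_pos[of "d * z"] by (simp add: F_def mult.assoc)

text \<open>At the argument \<open>z / d\<close> the common factor \<open>\<Psi> (z / d)\<close>
  cancels, and the denominator becomes \<open>\<Psi> z\<close>.\<close>

lemma F_tendsto_quotient:
  assumes c: "0 < c" "(F c \<longlongrightarrow> p) (at_right 0)"
    and d: "0 < d" "(F d \<longlongrightarrow> q) (at_right 0)" and q: "q \<noteq> 0"
  shows "(F (c / d) \<longlongrightarrow> p / q) (at_right 0)"
proof -
  have "((\<lambda>z. F c (1 / d * z) / F d (1 / d * z)) \<longlongrightarrow> p / q) (at_right 0)"
    using d(1) by (intro tendsto_divide q filterlim_compose[OF c(2)] filterlim_compose[OF d(2)]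
        filterlim_mult_at_right_0) simp_all
  then show ?thesis
  proof (rule Lim_transform_eventually)
    show "eventually (\<lambda>z. F c (1 / d * z) / F d (1 / d * z) = F (c / d) z) (at_right 0)"
      using eventually_at_right_less[of 0]
    proof eventually_elim
      case (elim z)
      then show ?case using d(1) Psi_pos[of "z / d"] by (simp add: F_def)
    qed
  qed
qed

text \<open>Any value of \<open>F c\<close> at the limit is squeezed between the limits of \<open>F d\<close> for \<open>d\<close> on either
  side of \<open>c\<close>, and these are dense.\<close>

lemma F_converges:
  assumes dense: "\<And>p. p \<in> \<rat> \<Longrightarrow> 0 < p \<Longrightarrow> \<exists>d>0. (F d \<longlongrightarrow> p) (at_right 0)"
    and c: "0 < c"
  shows "\<exists>l. (F c \<longlongrightarrow> l) (at_right 0)"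
proof -
  define S where "S = {q. \<exists>d\<ge>c. (F d \<longlongrightarrow> q) (at_right 0)}"
  have S_upper: "q \<le> max 1 (1 / c)" if "q \<in> S" for q
  proof -
    from that obtain d where d: "c \<le> d" "(F d \<longlongrightarrow> q) (at_right 0)" by (auto simp: S_def)
    from d(2) show ?thesis
    proof (rule tendsto_upperbound)
      show "eventually (\<lambda>z. F d z \<le> max 1 (1 / c)) (at_right 0)"
        using eventually_at_right_less[of 0]
      proof eventually_elim
        case (elim z)
        show ?case using F_antimono[OF c d(1) elim] F_bounds(2)[OF c elim] by linarith
      qed
    qed simp
  qed
  \<comment> \<open>Contrapositive of antimonotonicity in the scale: if \<open>F c\<close> is not
    eventually below \<open>F d\<close>, then \<open>d\<close> cannot lie to the left of
    \<open>c\<close>.\<close>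
  have S_iff: "p \<in> S" if d: "0 < d" "(F d \<longlongrightarrow> p) (at_right 0)"
    and freq: "\<not> eventually (\<lambda>z. F c z \<le> F d z) (at_right 0)" for d p
  proof -
    have "c \<le> d"
    proof (rule ccontr)
      assume "\<not> c \<le> d"
      then have "d \<le> c" by simp
      have "eventually (\<lambda>z. F c z \<le> F d z) (at_right 0)"
        using eventually_at_right_less[of 0]
        by eventually_elim (rule F_antimono[OF d(1) \<open>d \<le> c\<close>])
      then show False using freq by simp
    qed
    then show ?thesis using d by (auto simp: S_def)
  qed
  \<comment> \<open>A positive rational below the uniform lower bound of \<open>F c\<close> can only
    be the limit at a scale beyond \<open>c\<close>.\<close>
  have ne: "S \<noteq> {}"
  proof -
    have m: "0 < min 1 (1 / c)" using c by simp
    then obtain p where p: "p \<in> \<rat>" "0 < p" "p < min 1 (1 / c)" using Rats_dense_in_real by blast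
    obtain d where d: "0 < d" "(F d \<longlongrightarrow> p) (at_right 0)" using dense[OF p(1,2)] by blast
    have "p \<in> S"
    proof (rule S_iff[OF d] , rule notI)
      assume "eventually (\<lambda>z. F c z \<le> F d z) (at_right 0)"
      then have "eventually (\<lambda>z. min 1 (1 / c) \<le> F d z) (at_right 0)"
        using eventually_at_right_less[of 0]
        by eventually_elim (rule order_trans[OF F_bounds(1)[OF c]])
      then have "min 1 (1 / c) \<le> p" by (rule tendsto_lowerbound[OF d(2)]) simp
      then show False using p(3) by simp
    qed
    then show ?thesis by blast
  qed
  have bdd: "bdd_above S" using S_upper by (intro bdd_aboveI) auto
  have "(F c \<longlongrightarrow> Sup S) (at_right 0)"
  proof (rule order_tendstoI)
    fix a assume "a < Sup S"
    then obtain q where "q \<in> S" "a < q" using less_cSup_iff[OF ne bdd] by auto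
    then obtain d where d: "c \<le> d" "(F d \<longlongrightarrow> q) (at_right 0)" by (auto simp: S_def)
    show "eventually (\<lambda>z. a < F c z) (at_right 0)"
      using order_tendstoD(1)[OF d(2) \<open>a < q\<close>] eventually_at_right_less[of 0]
      by eventually_elim (rule less_le_trans[OF _ F_antimono[OF c d(1)]])
  next
    fix a assume a: "Sup S < a"
    \<comment> \<open>Ensures that a rational above \<open>Sup S\<close> is positive, as
      \<open>dense\<close> demands.\<close>
    have "0 \<le> Sup S"
    proof -
      obtain q where q: "q \<in> S" using ne by blast
      then obtain d where d: "c \<le> d" "(F d \<longlongrightarrow> q) (at_right 0)" by (auto simp: S_def)
      have "0 \<le> q"
        using d(2)
      proof (rule tendsto_lowerbound)
        show "eventually (\<lambda>z. 0 \<le> F d z) (at_right 0)"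
          using eventually_at_right_less[of 0]
          by eventually_elim (use F_pos c d(1) in \<open>simp add: less_imp_le\<close>)
      qed simp
      then show ?thesis using cSup_upper[OF q bdd] by simp
    qed
    obtain p where p: "p \<in> \<rat>" "Sup S < p" "p < a" using Rats_dense_in_real[OF a] by blast
    obtain d where d: "0 < d" "(F d \<longlongrightarrow> p) (at_right 0)"
      using dense[OF p(1)] p(2) \<open>0 \<le> Sup S\<close> by force
    have "eventually (\<lambda>z. F c z \<le> F d z) (at_right 0)"
      using S_iff[OF d] cSup_upper[OF _ bdd, of p] p(2) by linarith
    then show "eventually (\<lambda>z. F c z < a) (at_right 0)"
      using order_tendstoD(2)[OF d(2) p(3)] by eventually_elim simp
  qed
  then show ?thesis by blast
qed

text \<open>The limit is multiplicative in the scale and lies between \<open>min 1 (1 / c)\<close>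
  and \<open>max 1 (1 / c)\<close>. In logarithmic coordinates it is additive with
  \<open>- s \<le> f s \<le> 0\<close> for \<open>0 \<le> s\<close>, hence linear with slope in
  [-1,0].\<close>

lemma F_powr_limit:
  assumes conv: "\<And>c. 0 < c \<Longrightarrow> \<exists>l. (F c \<longlongrightarrow> l) (at_right 0)"
  obtains \<alpha> where "0 \<le> \<alpha>" "\<alpha> \<le> 1" "\<And>c. 0 < c \<Longrightarrow> (F c \<longlongrightarrow> c powr - \<alpha>) (at_right 0)"
proof -
  define \<phi> where "\<phi> c = Lim (at_right 0) (F c)" for c
  have lim: "(F c \<longlongrightarrow> \<phi> c) (at_right 0)" if "0 < c" for c
    using conv[OF that] tendsto_Lim[of "at_right (0::real)"] unfolding \<phi>_def by force
  have lower: "min 1 (1 / c) \<le> \<phi> c" if "0 < c" for c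
  proof (rule tendsto_lowerbound[OF lim[OF that]])
    show "eventually (\<lambda>z. min 1 (1 / c) \<le> F c z) (at_right 0)"
      using eventually_at_right_less[of 0] by eventually_elim (rule F_bounds(1)[OF that])
  qed simp
  have upper: "\<phi> c \<le> max 1 (1 / c)" if "0 < c" for c
  proof (rule tendsto_upperbound[OF lim[OF that]])
    show "eventually (\<lambda>z. F c z \<le> max 1 (1 / c)) (at_right 0)"
      using eventually_at_right_less[of 0] by eventually_elim (rule F_bounds(2)[OF that])
  qed simp
  have pos: "0 < \<phi> c" if "0 < c" for c
  proof -
    have "0 < min 1 (1 / c)" using that by simp
    then show ?thesis using lower[OF that] by linarith
  qed
  have mult: "\<phi> (c * d) = \<phi> c * \<phi> d" if "0 < c" "0 < d" for c d
  proof (rule tendsto_unique)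
    show "(F (c * d) \<longlongrightarrow> \<phi> (c * d)) (at_right 0)" using that by (intro lim) simp
    have "((\<lambda>z. F c (d * z) * F d z) \<longlongrightarrow> \<phi> c * \<phi> d) (at_right 0)"
      using that by (intro tendsto_mult lim filterlim_compose[OF lim] filterlim_mult_at_right_0)
    then show "(F (c * d) \<longlongrightarrow> \<phi> c * \<phi> d) (at_right 0)"
    proof (rule Lim_transform_eventually)
      show "eventually (\<lambda>z. F c (d * z) * F d z = F (c * d) z) (at_right 0)"
        using eventually_at_right_less[of 0]
        by eventually_elim (simp add: F_mult that)
    qed
  qed simp
  define f where "f s = ln (\<phi> (exp s))" for s
  have f_bounds: "- s \<le> f s" "f s \<le> 0" if "0 \<le> s" for s
  proof -
    have e: "1 / exp s = exp (- s)" "exp (- s) \<le> 1"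
      using that by (simp_all only: exp_minus inverse_eq_divide) simp
    then have "exp (- s) \<le> \<phi> (exp s)" "\<phi> (exp s) \<le> 1"
      using lower[OF exp_gt_zero, of s] upper[OF exp_gt_zero, of s]
      by (simp_all only: min.absorb2 max.absorb1)
    then have "ln (exp (- s)) \<le> f s" "f s \<le> ln 1"
      unfolding f_def using pos[OF exp_gt_zero, of s] by (simp_all only: ln_le_cancel_iff exp_gt_zero zero_less_one)
    then show "- s \<le> f s" "f s \<le> 0" by simp_all
  qed
  have f_lin: "f s = s * f 1" for s
  proof (rule additive_bounded_imp_linear[where f = f])
    show "f (s + t) = f s + f t" for s t
      using pos[of "exp s"] pos[of "exp t"] by (simp add: f_def exp_add mult ln_mult)
    show "\<bar>f s\<bar> \<le> s" if "0 \<le> s" for s using f_bounds[OF that] by (simp add: abs_le_iff)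
  qed
  show ?thesis
  proof
    show "0 \<le> - f 1" "- f 1 \<le> 1" using f_bounds[of 1] by simp_all
    fix c :: real assume c: "0 < c"
    have "\<phi> c = exp (f (ln c))" using c pos[OF c] by (simp add: f_def)
    also have "\<dots> = c powr - (- f 1)" using c f_lin[of "ln c"] by (simp add: powr_def mult.commute)
    finally show "(F c \<longlongrightarrow> c powr - (- f 1)) (at_right 0)" using lim[OF c] by simp
  qed
qed

text \<open>The limit law sends the scale with limit ratio \<open>p\<close> to a scale with limit ratio \<open>p + 1\<close>;
  starting at scale \<open>1\<close> all positive rational ratios are reached.\<close>

lemma F_regular:
  assumes g_pos: "\<And>l. 0 < l \<Longrightarrow> 0 < g l"
    and step: "\<And>l. 0 < l \<Longrightarrow> ((\<lambda>z. F (g l) z - F l z) \<longlongrightarrow> 1) (at_right 0)"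
  obtains \<alpha> where "0 < \<alpha>" "\<alpha> \<le> 1" "\<And>c. 0 < c \<Longrightarrow> (F c \<longlongrightarrow> c powr - \<alpha>) (at_right 0)"
proof -
  define \<gamma> where "\<gamma> n = (g ^^ n) 1" for n
  have \<gamma>_pos: "0 < \<gamma> n" for n by (induction n) (simp_all add: \<gamma>_def g_pos)
  have \<gamma>_lim: "(F (\<gamma> n) \<longlongrightarrow> real (Suc n)) (at_right 0)" for n
  proof (induction n)
    case 0
    have "eventually (\<lambda>z. 1 = F 1 z) (at_right 0)"
      using eventually_at_right_less[of 0]
    proof eventually_elim
      case (elim z)
      then show ?case using Psi_pos[of z] by (simp add: F_def)
    qed
    then have "(F 1 \<longlongrightarrow> 1) (at_right 0)" by (rule Lim_transform_eventually[OF tendsto_const])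
    then show ?case by (simp add: \<gamma>_def)
  next
    case (Suc n)
    have "((\<lambda>z. (F (g (\<gamma> n)) z - F (\<gamma> n) z) + F (\<gamma> n) z) \<longlongrightarrow> 1 + real (Suc n)) (at_right 0)"
      by (intro tendsto_add step \<gamma>_pos Suc)
    moreover have "\<gamma> (Suc n) = g (\<gamma> n)" by (simp add: \<gamma>_def)
    ultimately show ?case by simp
  qed
  have dense: "\<exists>d>0. (F d \<longlongrightarrow> p) (at_right 0)" if "p \<in> \<rat>" "0 < p" for p
  proof -
    obtain m n :: nat where mn: "n \<noteq> 0" "\<bar>p\<bar> = real m / real n"
      using \<open>p \<in> \<rat>\<close> by (elim Rats_abs_nat_div_natE)
    then have p: "p = real m / real n" using \<open>0 < p\<close> by simp
    with \<open>0 < p\<close> have "m \<noteq> 0" by (intro notI) simp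
    \<comment> \<open>The scale \<open>\<gamma> n\<close> has limit ratio \<open>n + 1\<close>, so
      the fraction \<open>m / n\<close> is reached with the indices \<open>m - 1\<close> and
      \<open>n - 1\<close>.\<close>
    then have "p = real (Suc (m - 1)) / real (Suc (n - 1))" using mn p by simp
    moreover have "(F (\<gamma> (m - 1) / \<gamma> (n - 1)) \<longlongrightarrow> real (Suc (m - 1)) / real (Suc (n - 1))) (at_right 0)"
      by (intro F_tendsto_quotient \<gamma>_pos \<gamma>_lim) simp
    ultimately show ?thesis using \<gamma>_pos by (metis divide_pos_pos)
  qed
  from F_converges[OF dense] obtain \<alpha> where \<alpha>: "0 \<le> \<alpha>" "\<alpha> \<le> 1"
    and lim: "\<And>c. 0 < c \<Longrightarrow> (F c \<longlongrightarrow> c powr - \<alpha>) (at_right 0)"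
    using F_powr_limit by blast
  \<comment> \<open>With exponent 0 every limit ratio would be 1.\<close>
  have "\<gamma> 1 powr - \<alpha> = 2"
    by (rule tendsto_unique[OF _ lim[OF \<gamma>_pos]]) (use \<gamma>_lim[of 1] in simp_all)
  then have "\<alpha> \<noteq> 0" using \<gamma>_pos[of 1] by (intro notI) simp
  with \<alpha> lim show ?thesis by (intro that) auto
qed

section \<open>From the tail integral back to the mechanism\<close>

text \<open>Monotone density argument: \<open>1 / \<psi>\<close> is the negative of the derivative of \<open>\<Psi>\<close> and decreases.\<close>

lemma psi_regular:
  assumes \<alpha>: "0 < \<alpha>" and lim: "\<And>c. 0 < c \<Longrightarrow> (F c \<longlongrightarrow> c powr - \<alpha>) (at_right 0)"
    and c: "0 < c"
  shows "((\<lambda>z. \<psi> (c * z) / \<psi> z) \<longlongrightarrow> c powr (1 + \<alpha>)) (at_right 0)"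
proof -
  \<comment> \<open>Since \<open>\<Psi>' = - 1 / \<psi>\<close>, the function \<open>Q\<close> is
    the negative logarithmic slope \<open>- z * \<Psi>' z / \<Psi> z\<close>, and \<open>q h\<close>
    is its difference quotient. As \<open>1 / \<psi>\<close> decreases, \<open>q h\<close> lies
    below \<open>Q\<close> for \<open>h > 0\<close> and above it for \<open>h < 0\<close>.\<close>
  define Q where "Q z = z / (\<psi> z * \<Psi> z)" for z
  define q where "q h z = (1 - F (1 + h) z) / h" for h z
  have mvt: "\<exists>\<xi>. z < \<xi> \<and> \<xi> < w \<and> \<Psi> z - \<Psi> w = (w - z) / \<psi> \<xi>" if "0 < z" "z < w" for z w
  proof -
    have "\<exists>\<xi>. z < \<xi> \<and> \<xi> < w \<and> \<Psi> w - \<Psi> z = (w - z) * (- 1 / \<psi> \<xi>)"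
      using that by (intro MVT2 DERIV_Psi) auto
    then show ?thesis by (auto simp: field_simps)
  qed
  have q_le: "q h z \<le> Q z" if h: "0 < h" and z: "0 < z" for h z
  proof -
    have "z < (1 + h) * z" using h z by simp
    then obtain \<xi> where \<xi>: "z < \<xi>" "\<Psi> z - \<Psi> ((1 + h) * z) = h * z / \<psi> \<xi>"
      using mvt[of z "(1 + h) * z"] z by (auto simp: algebra_simps)
    have "h * z / \<psi> \<xi> \<le> h * z / \<psi> z"
      using h z \<xi> psi_pos[of z] psi_mono[of z \<xi>] by (intro divide_left_mono) auto
    then have "\<Psi> z - \<Psi> ((1 + h) * z) \<le> h * z / \<psi> z" using \<xi>(2) by simp
    then have "(\<Psi> z - \<Psi> ((1 + h) * z)) / (h * \<Psi> z) \<le> (h * z / \<psi> z) / (h * \<Psi> z)"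
      using h Psi_pos[OF z] by (intro divide_right_mono) simp_all
    also have "\<dots> = Q z" using h by (simp add: Q_def)
    finally show ?thesis
      using Psi_pos[OF z] by (simp add: q_def F_def diff_divide_distrib mult.commute)
  qed
  have le_q: "Q z \<le> q h z" if h: "h < 0" "- 1 < h" and z: "0 < z" for h z
  proof -
    have "(1 + h) * z < z" "0 < (1 + h) * z" using h z by simp_all
    from mvt[OF this(2,1)] this(2) obtain \<xi> where \<xi>: "0 < \<xi>" "\<xi> < z"
      "\<Psi> ((1 + h) * z) - \<Psi> z = (z - (1 + h) * z) / \<psi> \<xi>"
      using less_trans by blast
    have diff: "z - (1 + h) * z = (- h) * z" by (simp add: algebra_simps)
    have "(- h) * z / \<psi> z \<le> (- h) * z / \<psi> \<xi>"
      using h z \<xi>(1,2) psi_pos[of \<xi>] psi_mono[of \<xi> z]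
      by (intro divide_left_mono) (auto simp: mult_le_0_iff)
    then have "(- h) * z / \<psi> z \<le> \<Psi> ((1 + h) * z) - \<Psi> z" using \<xi>(3) diff by simp
    then have "((- h) * z / \<psi> z) / ((- h) * \<Psi> z) \<le> (\<Psi> ((1 + h) * z) - \<Psi> z) / ((- h) * \<Psi> z)"
      using h Psi_pos[OF z] by (intro divide_right_mono) (simp_all add: mult_le_0_iff)
    moreover have "((- h) * z / \<psi> z) / ((- h) * \<Psi> z) = Q z" using h by (simp add: Q_def)
    ultimately show ?thesis
      using Psi_pos[OF z] by (simp add: q_def F_def diff_divide_distrib mult.commute)
  qed
  have q_lim: "(q h \<longlongrightarrow> (1 - (1 + h) powr - \<alpha>) / h) (at_right 0)" if "- 1 < h" "h \<noteq> 0" for h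
  proof -
    from \<open>- 1 < h\<close> have "0 < 1 + h" by simp
    from lim[OF this] show ?thesis
      unfolding q_def by (rule tendsto_divide[OF tendsto_diff[OF tendsto_const] tendsto_const \<open>h \<noteq> 0\<close>])
  qed
  \<comment> \<open>For fixed \<open>h\<close> the limit of \<open>q h\<close> at 0 is a difference
    quotient of \<open>- (x powr - \<alpha>)\<close> at 1. Choosing \<open>h\<close> small, of
    either sign, pins the limit of \<open>Q\<close> to the derivative
    \<open>\<alpha>\<close>.\<close>
  have "((\<lambda>x. - (x powr - \<alpha>)) has_real_derivative \<alpha>) (at 1)"
    using DERIV_minus[OF has_real_derivative_powr[of 1 "- \<alpha>"]] by simp
  then have slope: "((\<lambda>h. (1 - (1 + h) powr - \<alpha>) / h) \<longlongrightarrow> \<alpha>) (at 0)"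
    by (simp add: DERIV_def)
  have Q_lim: "(Q \<longlongrightarrow> \<alpha>) (at_right 0)"
  proof (rule order_tendstoI)
    fix a assume a: "a < \<alpha>"
    have "eventually (\<lambda>h. a < (1 - (1 + h) powr - \<alpha>) / h) (at_right 0)"
      using order_tendstoD(1)[OF slope a] by (auto simp: eventually_at_split)
    then have "eventually (\<lambda>h. a < (1 - (1 + h) powr - \<alpha>) / h \<and> 0 < h) (at_right 0)"
      using eventually_at_right_less[of 0] by (rule eventually_conj)
    then obtain h where h: "0 < h" "a < (1 - (1 + h) powr - \<alpha>) / h"
      using eventually_happens'[of "at_right (0::real)"] by auto
    have "- 1 < h" "h \<noteq> 0" using h(1) by simp_all
    from order_tendstoD(1)[OF q_lim[OF this] h(2)] eventually_at_right_less[of 0]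
    show "eventually (\<lambda>z. a < Q z) (at_right 0)"
      by eventually_elim (rule less_le_trans[OF _ q_le[OF h(1)]])
  next
    fix a assume a: "\<alpha> < a"
    have "eventually (\<lambda>h. (1 - (1 + h) powr - \<alpha>) / h < a) (at_left 0)"
      using order_tendstoD(2)[OF slope a] by (auto simp: eventually_at_split)
    moreover have "eventually (\<lambda>h::real. h \<in> {-1<..<0}) (at_left 0)"
      by (rule eventually_at_leftI[of "-1"]) auto
    ultimately have "eventually (\<lambda>h. (1 - (1 + h) powr - \<alpha>) / h < a \<and> h \<in> {-1<..<0}) (at_left 0)"
      by (rule eventually_conj)
    then obtain h where h: "h < 0" "- 1 < h" "(1 - (1 + h) powr - \<alpha>) / h < a"
      using eventually_happens'[of "at_left (0::real)"] by auto
    have "h \<noteq> 0" using h(1) by simp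
    from order_tendstoD(2)[OF q_lim[OF h(2) this] h(3)] eventually_at_right_less[of 0]
    show "eventually (\<lambda>z. Q z < a) (at_right 0)"
      by eventually_elim (rule le_less_trans[OF le_q[OF h(1,2)]])
  qed
  \<comment> \<open>All values of \<open>\<Psi>\<close> cancel in this expression, leaving
    \<open>\<psi> (c * z) / \<psi> z\<close>. Positivity of \<open>\<alpha>\<close> keeps the limit
    of the denominator nonzero.\<close>
  have "((\<lambda>z. c * Q z / (Q (c * z) * F c z)) \<longlongrightarrow> c * \<alpha> / (\<alpha> * c powr - \<alpha>)) (at_right 0)"
    using c \<alpha>
    by (intro tendsto_divide tendsto_mult tendsto_const Q_lim lim filterlim_compose[OF Q_lim]
        filterlim_mult_at_right_0) simp_all
  moreover have "c * \<alpha> / (\<alpha> * c powr - \<alpha>) = c powr (1 + \<alpha>)"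
    using c \<alpha> by (simp add: powr_add powr_minus divide_simps)
  ultimately have "((\<lambda>z. c * Q z / (Q (c * z) * F c z)) \<longlongrightarrow> c powr (1 + \<alpha>)) (at_right 0)" by simp
  then show ?thesis
  proof (rule Lim_transform_eventually)
    show "eventually (\<lambda>z. c * Q z / (Q (c * z) * F c z) = \<psi> (c * z) / \<psi> z) (at_right 0)"
      using eventually_at_right_less[of 0]
    proof eventually_elim
      case (elim z)
      then show ?case
        using c psi_pos[of z] psi_pos[of "c * z"] Psi_pos[of z] Psi_pos[of "c * z"]
        by (simp add: Q_def F_def field_simps)
    qed
  qed
qed

end

context mechanism_shape
begin

text \<open>The representation forces \<open>L x = x powr \<beta> * \<psi> (1 / x)\<close>. With
  \<open>z = 1 / x\<close>, its slow variation at infinity is the assumed limit at scale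
  \<open>1 / c\<close>.\<close>

lemma slowly_varying_repr:
  assumes lim: "\<And>c. 0 < c \<Longrightarrow> ((\<lambda>z. \<psi> (c * z) / \<psi> z) \<longlongrightarrow> c powr \<beta>) (at_right 0)"
  shows "\<exists>L. slowly_varying L \<and> (\<forall>l>0. \<psi> l = l powr \<beta> * L (1 / l))"
proof (intro exI conjI allI impI)
  let ?L = "\<lambda>x. x powr \<beta> * \<psi> (1 / x)"
  show "\<psi> l = l powr \<beta> * ?L (1 / l)" if "0 < l" for l
    using that by (simp add: powr_divide)
  show "slowly_varying ?L"
    unfolding slowly_varying_def
  proof (intro conjI allI impI)
    have "continuous_on {0<..} ?L"
      by (intro continuous_intros continuous_on_compose2[OF psi_continuous_on]) auto
    then show "?L \<in> borel_measurable (restrict_space borel {0<..})"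
      by (rule borel_measurable_continuous_on_restrict)
    show "0 < ?L x" if "0 < x" for x using that psi_pos[of "1 / x"] by simp
    fix c :: real assume c: "0 < c"
    have inv: "filterlim (\<lambda>x. 1 / x) (at_right 0) (at_top :: real filter)"
      using filterlim_inverse_at_right_top by (simp add: inverse_eq_divide)
    have "((\<lambda>x. c powr \<beta> * (\<psi> (1 / c * (1 / x)) / \<psi> (1 / x))) \<longlongrightarrow> c powr \<beta> * (1 / c) powr \<beta>) at_top"
      using c by (intro tendsto_intros filterlim_compose[OF lim inv]) simp
    also have "c powr \<beta> * (1 / c) powr \<beta> = 1" using c by (simp add: powr_divide)
    finally show "((\<lambda>x. ?L (c * x) / ?L x) \<longlongrightarrow> 1) at_top"
    proof (rule Lim_transform_eventually)
      show "eventually (\<lambda>x. c powr \<beta> * (\<psi> (1 / c * (1 / x)) / \<psi> (1 / x)) = ?L (c * x) / ?L x) at_top"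
        using eventually_gt_at_top[of 0]
        by eventually_elim (use c in \<open>simp add: powr_mult\<close>)
    qed
  qed
qed

end

section \<open>Extinction\<close>

locale extinction_cb = cb_process M P X \<psi> + grey_function \<psi> \<Psi>
  for M :: "'w measure" and P X \<psi> \<Psi>
begin

lemma space_P: "0 < x \<Longrightarrow> space (P x) = space M"
  using sets_P sets_eq_imp_space_eq by blast

lemma measurable_X_P: "0 < x \<Longrightarrow> 0 \<le> t \<Longrightarrow> X t \<in> borel_measurable (P x)"
  using measurable_X[of t] measurable_cong_sets[OF sets_P refl] by blast

lemma sets_X: "0 \<le> t \<Longrightarrow> B \<in> sets borel \<Longrightarrow> {\<omega> \<in> space M. X t \<omega> \<in> B} \<in> sets M"
  using measurable_sets[OF measurable_X] by (simp add: vimage_def Int_def conj_commute)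

text \<open>The chain rule gives \<open>\<Psi> (u s l)\<close> the derivative
  \<open>(- 1 / \<psi>) * (- \<psi>) = 1\<close> in \<open>s\<close>, so
  \<open>\<Psi> (u s l) - s\<close> is constant.\<close>

lemma cumulant_Psi:
  assumes u: "cumulant \<psi> u" and t: "0 \<le> t" and l: "0 < l"
  shows "\<Psi> (u t l) = t + \<Psi> l"
proof -
  have pos: "0 < u s l" and der: "((\<lambda>s. u s l) has_real_derivative - \<psi> (u s l)) (at s within {0..})"
    if "0 \<le> s" for s
    using u that l unfolding cumulant_def by (auto dest: spec[of _ l])
  have "((\<lambda>s. \<Psi> (u s l) - s) has_real_derivative 0) (at s within {0..})" if "s \<in> {0..}" for s
  proof -
    have s: "0 \<le> s" using that by simp
    have "((\<lambda>s. \<Psi> (u s l)) has_real_derivative - 1 / \<psi> (u s l) * - \<psi> (u s l)) (at s within {0..})"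
      by (rule DERIV_chain2[OF DERIV_Psi[OF pos[OF s]] der[OF s]])
    then have "((\<lambda>s. \<Psi> (u s l) - s) has_real_derivative
        - 1 / \<psi> (u s l) * - \<psi> (u s l) - 1) (at s within {0..})"
      by (rule DERIV_diff[OF _ DERIV_ident])
    then show ?thesis using psi_pos[OF pos[OF s]] by simp
  qed
  from has_field_derivative_zero_constant[OF convex_real_interval(1) this]
  obtain k where k: "\<And>s. 0 \<le> s \<Longrightarrow> \<Psi> (u s l) - s = k" by auto
  have "u 0 l = l" using u l unfolding cumulant_def by simp
  then show ?thesis using k[of 0] k[OF t] by simp
qed

lemma laplace_Psi:
  assumes t: "0 \<le> t" and l: "0 < l"
  obtains u where "0 < u" "u \<le> l" "\<Psi> u = t + \<Psi> l"
    "\<And>x. 0 < x \<Longrightarrow> (\<integral>\<omega>. exp (- l * X t \<omega>) \<partial>P x) = exp (- x * u)"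
proof -
  obtain u where u: "cumulant \<psi> u"
    and L: "\<And>x t l. 0 < x \<Longrightarrow> 0 \<le> t \<Longrightarrow> 0 \<le> l \<Longrightarrow> (\<integral>\<omega>. exp (- l * X t \<omega>) \<partial>P x) = exp (- x * u t l)"
    using laplace by blast
  have pos: "0 < u t l" using u t l unfolding cumulant_def by simp
  have eq: "\<Psi> (u t l) = t + \<Psi> l" by (rule cumulant_Psi[OF u t l])
  then have "\<not> \<Psi> (u t l) < \<Psi> l" using t by simp
  then have le: "u t l \<le> l" using Psi_less_iff[OF l pos] by simp
  show ?thesis
  proof (rule that)
    show "0 < u t l" "u t l \<le> l" "\<Psi> (u t l) = t + \<Psi> l" by fact+
    show "(\<integral>\<omega>. exp (- l * X t \<omega>) \<partial>P x) = exp (- x * u t l)" if "0 < x" for x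
      using L[OF that t, of l] l by simp
  qed
qed

text \<open>Markov's inequality for \<open>1 - exp (- X s)\<close>: its mean
  \<open>1 - exp (- y * u)\<close> is at most \<open>y\<close>, because \<open>u \<le> 1\<close>.
  The bound is uniform in \<open>s\<close> and vanishes with \<open>y\<close>.\<close>

lemma prob_exceeds_le:
  assumes y: "0 < y" and s: "0 \<le> s" and d: "0 < \<delta>"
  shows "measure (P y) {\<omega> \<in> space M. X s \<omega> \<in> {\<delta><..}} \<le> y / (1 - exp (- \<delta>))"
proof -
  interpret prob_space "P y" using y by (rule prob_space_P)
  note [measurable] = measurable_X_P[OF y s]
  obtain u where u: "0 < u" "u \<le> 1" and L: "(\<integral>\<omega>. exp (- 1 * X s \<omega>) \<partial>P y) = exp (- y * u)"
    using laplace_Psi[OF s zero_less_one] y by metis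
  have e: "0 < 1 - exp (- \<delta>)" using d by simp
  have X0: "0 \<le> X s \<omega>" if "\<omega> \<in> space (P y)" for \<omega> using nonneg[OF s] that space_P[OF y] by simp
  have int: "integrable (P y) (\<lambda>\<omega>. exp (- X s \<omega>))"
    by (rule integrable_const_bound[of _ 1]) (use X0 in auto)
  let ?A = "{\<omega> \<in> space M. X s \<omega> \<in> {\<delta><..}}"
  have A: "?A \<in> events" using sets_X[OF s, of "{\<delta><..}"] sets_P[OF y] by simp
  have "prob ?A = (\<integral>\<omega>. indicator ?A \<omega> \<partial>P y)" using A by simp
  also have "\<dots> \<le> (\<integral>\<omega>. (1 - exp (- X s \<omega>)) / (1 - exp (- \<delta>)) \<partial>P y)"
  proof (rule integral_mono)
    show "integrable (P y) (indicator ?A :: _ \<Rightarrow> real)"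
      using A by (simp add: integrable_indicator_iff emeasure_eq_measure)
    show "integrable (P y) (\<lambda>\<omega>. (1 - exp (- X s \<omega>)) / (1 - exp (- \<delta>)))"
      by (intro integrable_divide Bochner_Integration.integrable_diff int) simp
    fix \<omega> assume w: "\<omega> \<in> space (P y)"
    show "indicator ?A \<omega> \<le> (1 - exp (- X s \<omega>)) / (1 - exp (- \<delta>))"
    proof (cases "\<omega> \<in> ?A")
      case True
      then have "1 - exp (- \<delta>) \<le> 1 - exp (- X s \<omega>)" by simp
      then show ?thesis using True e by (simp add: le_divide_eq_1)
    next
      case False
      then show ?thesis using X0[OF w] e by simp
    qed
  qed
  also have "\<dots> = (1 - exp (- y * u)) / (1 - exp (- \<delta>))"
    using L int by (simp add: prob_space)
  also have "\<dots> \<le> y / (1 - exp (- \<delta>))"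
  proof (rule divide_right_mono)
    have "1 - exp (- (y * u)) \<le> y * u" using exp_ge_add_one_self[of "- (y * u)"] by simp
    also have "\<dots> \<le> y * 1" using u y by (intro mult_left_mono) auto
    finally show "1 - exp (- y * u) \<le> y" by simp
  qed (use e in simp)
  finally show ?thesis .
qed

lemma kernel_exceeds_le:
  assumes y: "0 \<le> y" and s: "0 \<le> s" and d: "0 < \<delta>"
  shows "emeasure (transition_kernel P X s y) {\<delta><..} \<le> ennreal (y / (1 - exp (- \<delta>)))"
proof (cases "0 < y")
  case True
  interpret prob_space "P y" using True by (rule prob_space_P)
  have "emeasure (transition_kernel P X s y) {\<delta><..} = emeasure (P y) (X s -` {\<delta><..} \<inter> space (P y))"
    using True measurable_X_P[OF True s] by (simp add: transition_kernel_def emeasure_distr)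
  also have "X s -` {\<delta><..} \<inter> space (P y) = {\<omega> \<in> space M. X s \<omega> \<in> {\<delta><..}}"
    using space_P[OF True] by auto
  also have "emeasure (P y) \<dots> \<le> ennreal (y / (1 - exp (- \<delta>)))"
    unfolding emeasure_eq_measure by (intro ennreal_leI prob_exceeds_le True s d)
  finally show ?thesis .
next
  case False
  then show ?thesis using y d by (simp add: transition_kernel_def)
qed

section \<open>Paths that come close to zero\<close>

lemma filtration_generators_subset: "{X s -` B \<inter> space M | s B. 0 \<le> s \<and> ennreal s \<le> t \<and> B \<in> sets borel} \<subseteq> Pow (space M)"
  by auto

lemma space_generated_filtration: "space (generated_filtration M X t) = space M"
  using filtration.space_F[OF filtration_generated_filtration] .

lemma sets_generated_filtration:
  assumes "0 \<le> s" "s \<le> r" "B \<in> sets borel"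
  shows "{\<omega> \<in> space M. X s \<omega> \<in> B} \<in> sets (generated_filtration M X (ennreal r))"
proof -
  have "X s -` B \<inter> space M \<in> {X s -` B \<inter> space M | s B. 0 \<le> s \<and> ennreal s \<le> ennreal r \<and> B \<in> sets borel}"
    using assms ennreal_leI by blast
  then have "X s -` B \<inter> space M \<in> sets (generated_filtration M X (ennreal r))"
    unfolding generated_filtration_def sets_measure_of[OF filtration_generators_subset]
    by (rule sigma_sets.Basic)
  also have "X s -` B \<inter> space M = {\<omega> \<in> space M. X s \<omega> \<in> B}" by auto
  finally show ?thesis .
qed

text \<open>The strong Markov property at a constant stopping time; an event of the filtration at
  \<open>r\<close> is prior to that time.\<close>

lemma markov:
  assumes x: "0 < x" and r: "0 \<le> r" and s: "0 \<le> s" and B: "B \<in> sets borel"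
    and A: "A \<in> sets (generated_filtration M X (ennreal r))"
  shows "emeasure (P x) {\<omega> \<in> A. X (r + s) \<omega> \<in> B} =
    (\<integral>\<^sup>+\<omega>\<in>A. emeasure (transition_kernel P X s (X r \<omega>)) B \<partial>P x)"
proof -
  interpret F: filtration "space M" "generated_filtration M X"
    by (rule filtration_generated_filtration)
  let ?T = "\<lambda>_::'w. ennreal r"
  have T: "stopping_time (generated_filtration M X) ?T" by (rule stopping_time_const)
  have "A \<in> sets (F.pre_sigma ?T)"
  proof (rule F.sets_pre_sigmaI[OF T])
    fix t
    show "{\<omega> \<in> A. ennreal r \<le> t} \<in> sets (generated_filtration M X t)"
      using A F.sets_F_mono[of "ennreal r" t] by (cases "ennreal r \<le> t") auto
  qed
  with strong_markov x T s B
  have "emeasure (P x) {\<omega> \<in> A. ?T \<omega> < \<infinity> \<and> X (enn2real (?T \<omega>) + s) \<omega> \<in> B} =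
    (\<integral>\<^sup>+\<omega>\<in>{\<omega> \<in> A. ?T \<omega> < \<infinity>}.
      emeasure (transition_kernel P X s (X (enn2real (?T \<omega>)) \<omega>)) B \<partial>P x)"
    unfolding strong_markov_def by blast
  then show ?thesis using r by simp
qed

text \<open>First passage below \<open>\<epsilon>\<close> along a finite set of times, and the Markov property there.\<close>

lemma prob_small_then_exceeds_finite:
  assumes x: "0 < x" and S: "finite S" "S \<subseteq> {0..t}" and eps: "0 < \<epsilon>" and d: "0 < \<delta>"
  shows "emeasure (P x) {\<omega> \<in> space M. (\<exists>s\<in>S. X s \<omega> < \<epsilon>) \<and> \<delta> < X t \<omega>}
    \<le> ennreal (\<epsilon> / (1 - exp (- \<delta>)))"
proof -
  interpret prob_space "P x" using x by (rule prob_space_P)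
  let ?C = "ennreal (\<epsilon> / (1 - exp (- \<delta>)))"
  have e: "0 < 1 - exp (- \<delta>)" using d by simp
  \<comment> \<open>\<open>A s\<close> says that \<open>s\<close> is the first time in
    \<open>S\<close> with the path below \<open>\<epsilon>\<close>. These events are disjoint, so
    their probabilities add up to at most 1 and the final bound does not grow with
    \<open>S\<close>.\<close>
  define A where "A s = {\<omega> \<in> space M. X s \<omega> < \<epsilon> \<and> (\<forall>r\<in>S. r < s \<longrightarrow> \<epsilon> \<le> X r \<omega>)}" for s
  have A_iff: "\<omega> \<in> A s \<longleftrightarrow> \<omega> \<in> space M \<and> X s \<omega> < \<epsilon> \<and> (\<forall>r\<in>S. r < s \<longrightarrow> \<epsilon> \<le> X r \<omega>)" for \<omega> s
    by (auto simp: A_def)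
  have S0: "0 \<le> s" "s \<le> t" if "s \<in> S" for s using S that by auto
  have A_F: "A s \<in> sets (generated_filtration M X (ennreal s))" if s: "s \<in> S" for s
  proof -
    let ?F = "generated_filtration M X (ennreal s)"
    have "A s = {\<omega> \<in> space ?F. X s \<omega> \<in> {..<\<epsilon>} \<and> (\<forall>r\<in>{r \<in> S. r < s}. X r \<omega> \<in> {\<epsilon>..})}"
      by (auto simp: A_iff space_generated_filtration)
    also have "\<dots> \<in> sets ?F"
    proof (intro sets.sets_Collect_conj sets.sets_Collect_finite_All)
      show "{\<omega> \<in> space ?F. X s \<omega> \<in> {..<\<epsilon>}} \<in> sets ?F"
        unfolding space_generated_filtration by (rule sets_generated_filtration) (use S0 s in auto)
      show "{\<omega> \<in> space ?F. X r \<omega> \<in> {\<epsilon>..}} \<in> sets ?F" if "r \<in> {r \<in> S. r < s}" for r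
        unfolding space_generated_filtration by (rule sets_generated_filtration) (use S0 that in auto)
    qed (use S in simp)
    finally show ?thesis .
  qed
  have A_sets: "A s \<in> events" if s: "s \<in> S" for s
  proof -
    have "A s = {\<omega> \<in> space M. X s \<omega> \<in> {..<\<epsilon>} \<and> (\<forall>r\<in>{r \<in> S. r < s}. X r \<omega> \<in> {\<epsilon>..})}"
      by (auto simp: A_iff)
    also have "\<dots> \<in> sets M"
      by (intro sets.sets_Collect_conj sets.sets_Collect_finite_All sets_X) (use S S0 s in auto)
    finally show ?thesis using sets_P[OF x] by simp
  qed
  define D where "D s = {\<omega> \<in> A s. X t \<omega> \<in> {\<delta><..}}" for s
  have D_sets: "D s \<in> events" if s: "s \<in> S" for s
  proof -
    have "0 \<le> t" using S0[OF s] by simp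
    then have "A s \<inter> {\<omega> \<in> space M. X t \<omega> \<in> {\<delta><..}} \<in> events"
      using A_sets[OF s] sets_X[of t "{\<delta><..}"] sets_P[OF x] by (intro sets.Int) simp_all
    also have "A s \<inter> {\<omega> \<in> space M. X t \<omega> \<in> {\<delta><..}} = D s" by (auto simp: D_def A_iff)
    finally show ?thesis .
  qed
  have D_le: "emeasure (P x) (D s) \<le> ?C * emeasure (P x) (A s)" if s: "s \<in> S" for s
  proof -
    have "emeasure (P x) (D s) = (\<integral>\<^sup>+\<omega>\<in>A s. emeasure (transition_kernel P X (t - s) (X s \<omega>)) {\<delta><..} \<partial>P x)"
      using markov[OF x _ _ _ A_F[OF s], of "t - s" "{\<delta><..}"] S0[OF s] by (simp add: D_def)
    also have "\<dots> \<le> (\<integral>\<^sup>+\<omega>. ?C * indicator (A s) \<omega> \<partial>P x)"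
    proof (intro nn_integral_mono)
      fix \<omega>
      show "emeasure (transition_kernel P X (t - s) (X s \<omega>)) {\<delta><..} * indicator (A s) \<omega>
          \<le> ?C * indicator (A s) \<omega>"
      proof (cases "\<omega> \<in> A s")
        case True
        then have X: "0 \<le> X s \<omega>" "X s \<omega> \<le> \<epsilon>" using nonneg[of s \<omega>] S0[OF s] by (auto simp: A_iff)
        have "emeasure (transition_kernel P X (t - s) (X s \<omega>)) {\<delta><..} \<le> ennreal (X s \<omega> / (1 - exp (- \<delta>)))"
          by (rule kernel_exceeds_le) (use X S0[OF s] d in auto)
        also have "\<dots> \<le> ?C" using X e by (intro ennreal_leI divide_right_mono) auto
        finally show ?thesis using True by simp
      qed simp
    qed
    also have "\<dots> = ?C * emeasure (P x) (A s)"
      using A_sets[OF s] by (rule nn_integral_cmult_indicator)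
    finally show ?thesis .
  qed
  have disj: "disjoint_family_on A S"
    unfolding disjoint_family_on_def by (force simp: A_iff neq_iff)
  have "{\<omega> \<in> space M. (\<exists>s\<in>S. X s \<omega> < \<epsilon>) \<and> \<delta> < X t \<omega>} \<subseteq> (\<Union>s\<in>S. D s)"
  proof
    fix \<omega> assume w: "\<omega> \<in> {\<omega> \<in> space M. (\<exists>s\<in>S. X s \<omega> < \<epsilon>) \<and> \<delta> < X t \<omega>}"
    define s where "s = Min {s \<in> S. X s \<omega> < \<epsilon>}"
    have fin: "finite {s \<in> S. X s \<omega> < \<epsilon>}" and ne: "{s \<in> S. X s \<omega> < \<epsilon>} \<noteq> {}" using S w by auto
    have "s \<in> {s \<in> S. X s \<omega> < \<epsilon>}" unfolding s_def using fin ne by (rule Min_in)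
    moreover have "\<epsilon> \<le> X r \<omega>" if "r \<in> S" "r < s" for r
    proof (rule ccontr)
      assume "\<not> \<epsilon> \<le> X r \<omega>"
      then have "s \<le> r" unfolding s_def using that(1) fin by (intro Min_le) auto
      then show False using that(2) by simp
    qed
    ultimately have "\<omega> \<in> D s" "s \<in> S" using w by (auto simp: D_def A_iff)
    then show "\<omega> \<in> (\<Union>s\<in>S. D s)" by blast
  qed
  then have "emeasure (P x) {\<omega> \<in> space M. (\<exists>s\<in>S. X s \<omega> < \<epsilon>) \<and> \<delta> < X t \<omega>} \<le> emeasure (P x) (\<Union>s\<in>S. D s)"
    using S(1) D_sets by (intro emeasure_mono) auto
  also have "\<dots> \<le> (\<Sum>s\<in>S. emeasure (P x) (D s))"
    using S(1) D_sets by (intro emeasure_subadditive_finite) auto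
  also have "\<dots> \<le> (\<Sum>s\<in>S. ?C * emeasure (P x) (A s))" by (intro sum_mono D_le)
  also have "\<dots> = ?C * emeasure (P x) (\<Union>s\<in>S. A s)"
    using S(1) disj A_sets by (subst sum_emeasure[symmetric]) (auto simp: sum_distrib_left)
  also have "\<dots> \<le> ?C * 1" by (intro mult_left_mono emeasure_le_1) simp
  finally show ?thesis by simp
qed

text \<open>The finite bound is independent of the number of times, so it survives the increasing
  union over finite subsets of \<open>Q\<close>.\<close>

lemma prob_small_then_exceeds_countable:
  assumes x: "0 < x" and Q: "countable Q" "Q \<subseteq> {0..t}" "Q \<noteq> {}" and eps: "0 < \<epsilon>" and d: "0 < \<delta>"
  shows "{\<omega> \<in> space M. (\<exists>s\<in>Q. X s \<omega> < \<epsilon>) \<and> \<delta> < X t \<omega>} \<in> sets (P x)" (is "?A \<in> _")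
    and "emeasure (P x) {\<omega> \<in> space M. (\<exists>s\<in>Q. X s \<omega> < \<epsilon>) \<and> \<delta> < X t \<omega>}
      \<le> ennreal (\<epsilon> / (1 - exp (- \<delta>)))"
proof -
  define q where "q = from_nat_into Q"
  have q: "range q = Q" unfolding q_def using Q by (intro range_from_nat_into)
  define B where "B n = {\<omega> \<in> space M. (\<exists>s\<in>q ` {..n}. X s \<omega> < \<epsilon>) \<and> \<delta> < X t \<omega>}" for n :: nat
  have q0: "0 \<le> q i" "q i \<le> t" for i using subsetD[OF Q(2), of "q i"] q by auto
  have t: "0 \<le> t" using q0[of 0] by simp
  have B_sets: "B n \<in> sets (P x)" for n
  proof -
    have "B n = {\<omega> \<in> space M. (\<exists>i\<in>{..n}. X (q i) \<omega> \<in> {..<\<epsilon>}) \<and> X t \<omega> \<in> {\<delta><..}}"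
      by (auto simp: B_def)
    also have "\<dots> \<in> sets M"
      by (intro sets.sets_Collect_conj sets.sets_Collect_finite_Ex sets_X q0 t) auto
    finally show ?thesis using sets_P[OF x] by simp
  qed
  have A: "?A = (\<Union>n. B n)" unfolding q[symmetric] B_def by auto
  show "?A \<in> sets (P x)" unfolding A using B_sets by blast
  have "emeasure (P x) ?A = (SUP n. emeasure (P x) (B n))"
    unfolding A
  proof (rule SUP_emeasure_incseq[symmetric])
    show "range B \<subseteq> sets (P x)" using B_sets by blast
    show "incseq B" unfolding incseq_def B_def by force
  qed
  also have "\<dots> \<le> ennreal (\<epsilon> / (1 - exp (- \<delta>)))"
    unfolding B_def
    by (intro SUP_least prob_small_then_exceeds_finite x eps d) (use q0 in auto)
  finally show "emeasure (P x) ?A \<le> ennreal (\<epsilon> / (1 - exp (- \<delta>)))" .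
qed

text \<open>After a zero at \<open>s < t\<close>, right continuity makes the path smaller than any
  \<open>1 / Suc n\<close> at rational times in between. The uncountably many \<open>s\<close> are
  thus covered by the intersection of the events \<open>A n\<close>, whose probabilities are of
  order \<open>1 / n\<close>.\<close>

lemma AE_not_zero_before_exceeds:
  assumes x: "0 < x" and t: "0 \<le> t" and d: "0 < \<delta>"
  shows "AE \<omega> in P x. \<delta> < X t \<omega> \<longrightarrow> (\<forall>s\<in>{0..<t}. X s \<omega> \<noteq> 0)"
proof (cases "t = 0")
  case False
  define Q where "Q = \<rat> \<inter> {0..<t}"
  have Q: "countable Q" "Q \<subseteq> {0..t}" "Q \<noteq> {}"
    using False t by (auto simp: Q_def countable_rat intro!: exI[of _ 0])
  define A where "A n = {\<omega> \<in> space M. (\<exists>s\<in>Q. X s \<omega> < 1 / real (Suc n)) \<and> \<delta> < X t \<omega>}" for n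
  have A_sets: "A n \<in> sets (P x)" for n
    unfolding A_def by (rule prob_small_then_exceeds_countable(1)[OF x Q _ d]) simp
  have A_le: "emeasure (P x) (A n) \<le> ennreal (1 / real (Suc n) / (1 - exp (- \<delta>)))" for n
    unfolding A_def by (rule prob_small_then_exceeds_countable(2)[OF x Q _ d]) simp
  have I: "(\<Inter>n. A n) \<in> sets (P x)" using A_sets by blast
  have null: "emeasure (P x) (\<Inter>n. A n) = 0"
  proof -
    have "(\<lambda>n. 1 / real (Suc n) / (1 - exp (- \<delta>))) \<longlonglongrightarrow> 0 / (1 - exp (- \<delta>))"
      using d LIMSEQ_inverse_real_of_nat by (intro tendsto_divide tendsto_const) (auto simp: inverse_eq_divide)
    then have "(\<lambda>n. ennreal (1 / real (Suc n) / (1 - exp (- \<delta>)))) \<longlonglongrightarrow> ennreal 0"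
      by (intro tendsto_ennrealI) simp
    then have "emeasure (P x) (\<Inter>n. A n) \<le> ennreal 0"
    proof (rule LIMSEQ_le_const, intro exI allI impI)
      fix n
      have "emeasure (P x) (\<Inter>n. A n) \<le> emeasure (P x) (A n)"
        using A_sets by (intro emeasure_mono) auto
      then show "emeasure (P x) (\<Inter>n. A n) \<le> ennreal (1 / real (Suc n) / (1 - exp (- \<delta>)))"
        using A_le[of n] by (rule order_trans)
    qed
    then show ?thesis by simp
  qed
  show ?thesis
  proof (rule AE_I[OF _ null I], rule subsetI)
    fix \<omega> assume "\<omega> \<in> {\<omega> \<in> space (P x). \<not> (\<delta> < X t \<omega> \<longrightarrow> (\<forall>s\<in>{0..<t}. X s \<omega> \<noteq> 0))}"
    then obtain s where w: "\<omega> \<in> space M" "\<delta> < X t \<omega>" and s: "0 \<le> s" "s < t" "X s \<omega> = 0"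
      using space_P[OF x] by auto
    show "\<omega> \<in> (\<Inter>n. A n)"
    proof
      fix n
      have "((\<lambda>r. X r \<omega>) \<longlongrightarrow> X s \<omega>) (at_right s)"
        using right_continuous[OF s(1) w(1)] by (simp add: continuous_within)
      then have "eventually (\<lambda>r. X r \<omega> < 1 / real (Suc n)) (at_right s)"
        by (rule order_tendstoD(2)) (simp add: s(3))
      then obtain b where b: "s < b" "\<And>r. s < r \<Longrightarrow> r < b \<Longrightarrow> X r \<omega> < 1 / real (Suc n)"
        unfolding eventually_at_right_field by blast
      obtain r where "r \<in> \<rat>" "s < r" "r < min b t"
        using Rats_dense_in_real[of s "min b t"] b(1) s(2) by auto
      then have "r \<in> Q" "X r \<omega> < 1 / real (Suc n)" using s(1) b(2) by (auto simp: Q_def)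
      then show "\<omega> \<in> A n" using w by (auto simp: A_def)
    qed
  qed
qed simp

text \<open>If \<open>X t\<close> is positive it exceeds some \<open>1 / Suc n\<close>, so almost
  surely no zero precedes \<open>t\<close>. Right continuity also excludes zeros on an interval from
  \<open>t\<close> to \<open>b > t\<close>; this gap makes the infimum strictly larger than
  \<open>t\<close>.\<close>

lemma AE_extinction_time:
  assumes x: "0 < x" and t: "0 \<le> t"
  shows "AE \<omega> in P x. ennreal t < extinction_time X \<omega> \<longleftrightarrow> 0 < X t \<omega>"
proof -
  have "AE \<omega> in P x. \<forall>n::nat. 1 / real (Suc n) < X t \<omega> \<longrightarrow> (\<forall>s\<in>{0..<t}. X s \<omega> \<noteq> 0)"
    unfolding AE_all_countable by (intro allI AE_not_zero_before_exceeds x t) simp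
  then show ?thesis
    using AE_space
  proof eventually_elim
    case (elim \<omega>)
    then have w: "\<omega> \<in> space M" using space_P[OF x] by simp
    show ?case
    proof
      assume less: "ennreal t < extinction_time X \<omega>"
      have "X t \<omega> \<noteq> 0"
      proof
        assume "X t \<omega> = 0"
        then have "extinction_time X \<omega> \<le> ennreal t"
          unfolding extinction_time_def using t by (intro INF_lower) simp
        then show False using less by simp
      qed
      then show "0 < X t \<omega>" using nonneg[OF t w] by simp
    next
      assume pos: "0 < X t \<omega>"
      obtain n :: nat where "1 / real (Suc n) < X t \<omega>"
        using reals_Archimedean[OF pos] by (auto simp: inverse_eq_divide)
      then have before: "X s \<omega> \<noteq> 0" if "0 \<le> s" "s < t" for s using elim(1) that by auto
      have "((\<lambda>r. X r \<omega>) \<longlongrightarrow> X t \<omega>) (at_right t)"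
        using right_continuous[OF t w] by (simp add: continuous_within)
      then have "eventually (\<lambda>r. 0 < X r \<omega>) (at_right t)"
        using pos by (rule order_tendstoD(1))
      then obtain b where b: "t < b" "\<And>r. t < r \<Longrightarrow> r < b \<Longrightarrow> 0 < X r \<omega>"
        unfolding eventually_at_right_field by blast
      have "ennreal b \<le> extinction_time X \<omega>"
        unfolding extinction_time_def
      proof (rule INF_greatest)
        fix s assume "s \<in> {t. 0 \<le> t \<and> X t \<omega> = 0}"
        then have s: "0 \<le> s" "X s \<omega> = 0" by auto
        have "b \<le> s" using before[of s] b(2)[of s] s pos by (cases s t rule: linorder_cases) force+
        then show "ennreal b \<le> ennreal s" by (rule ennreal_leI)
      qed
      moreover have "ennreal t < ennreal b" using t b(1) by (simp add: ennreal_less_iff)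
      ultimately show "ennreal t < extinction_time X \<omega>" by simp
    qed
  qed
qed

end

section \<open>The conditional limit law\<close>

context extinction_cb
begin

text \<open>Along \<open>n + 1\<close> as Laplace argument, the transform tends to the probability
  of the state 0. On the other side \<open>\<Psi> (u n) = \<Psi> z + \<Psi> (n + 1)\<close>
  decreases to \<open>\<Psi> z\<close>, so \<open>u n\<close> tends to \<open>z\<close>.\<close>

lemma prob_extinct:
  assumes x: "0 < x" and z: "0 < z"
  shows "measure (P x) {\<omega> \<in> space M. X (\<Psi> z) \<omega> \<in> {0}} = exp (- x * z)"
proof -
  interpret prob_space "P x" using x by (rule prob_space_P)
  let ?t = "\<Psi> z"
  have t: "0 \<le> ?t" using Psi_pos[OF z] by simp
  note [measurable] = measurable_X_P[OF x t]
  have X0: "0 \<le> X ?t \<omega>" if "\<omega> \<in> space (P x)" for \<omega> using nonneg[OF t] that space_P[OF x] by simp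
  let ?A = "{\<omega> \<in> space M. X ?t \<omega> \<in> {0}}"
  have A: "?A \<in> events" using sets_X[OF t, of "{0}"] sets_P[OF x] by simp
  have "\<forall>n. \<exists>u. 0 < u \<and> \<Psi> u = ?t + \<Psi> (real (Suc n)) \<and>
      (\<integral>\<omega>. exp (- real (Suc n) * X ?t \<omega>) \<partial>P x) = exp (- x * u)"
  proof
    fix n :: nat
    have "0 < real (Suc n)" by simp
    from laplace_Psi[OF t this] x
    show "\<exists>u. 0 < u \<and> \<Psi> u = ?t + \<Psi> (real (Suc n)) \<and>
      (\<integral>\<omega>. exp (- real (Suc n) * X ?t \<omega>) \<partial>P x) = exp (- x * u)" by metis
  qed
  then obtain u where u: "\<And>n. 0 < u n" "\<And>n. \<Psi> (u n) = ?t + \<Psi> (real (Suc n))"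
    "\<And>n. (\<integral>\<omega>. exp (- real (Suc n) * X ?t \<omega>) \<partial>P x) = exp (- x * u n)" by metis
  have "(\<lambda>n. \<integral>\<omega>. exp (- real (Suc n) * X ?t \<omega>) \<partial>P x) \<longlonglongrightarrow> (\<integral>\<omega>. indicator ?A \<omega> \<partial>P x)"
  proof (rule integral_dominated_convergence[where w = "\<lambda>_. 1"])
    show "AE \<omega> in P x. (\<lambda>n. exp (- real (Suc n) * X ?t \<omega>)) \<longlonglongrightarrow> indicator ?A \<omega>"
    proof (rule AE_I2)
      fix \<omega> assume w: "\<omega> \<in> space (P x)"
      show "(\<lambda>n. exp (- real (Suc n) * X ?t \<omega>)) \<longlonglongrightarrow> indicator ?A \<omega>"
      proof (cases "X ?t \<omega> = 0")
        case True
        then show ?thesis using w space_P[OF x] by simp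
      next
        case False
        then have "0 < X ?t \<omega>" using X0[OF w] by simp
        then have "exp (- X ?t \<omega>) < 1" by simp
        then have "(\<lambda>n. exp (- X ?t \<omega>) ^ Suc n) \<longlonglongrightarrow> 0"
          by (intro LIMSEQ_Suc LIMSEQ_realpow_zero) simp_all
        moreover have "exp (- X ?t \<omega>) ^ Suc n = exp (- real (Suc n) * X ?t \<omega>)" for n
          by (simp only: exp_of_nat_mult[symmetric] mult_minus_left mult_minus_right)
        moreover have "indicator ?A \<omega> = (0 :: real)" using False by simp
        ultimately show ?thesis by (simp only:)
      qed
    qed
    show "AE \<omega> in P x. norm (exp (- real (Suc n) * X ?t \<omega>)) \<le> 1" for n
      by (rule AE_I2) (use X0 in \<open>simp add: mult_le_0_iff\<close>)
    show "(\<lambda>\<omega>. indicator ?A \<omega> :: real) \<in> borel_measurable (P x)" using A by simp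
  qed simp_all
  then have L: "(\<lambda>n. exp (- x * u n)) \<longlonglongrightarrow> prob ?A" using A by (simp only: u(3)) simp
  have u_lim: "u \<longlonglongrightarrow> z"
  proof (rule order_tendstoI)
    fix a assume a: "a < z"
    show "eventually (\<lambda>n. a < u n) sequentially"
    proof (cases "0 < a")
      case True
      have "0 < \<Psi> a - \<Psi> z" using Psi_strict_antimono[OF True a] by simp
      moreover have "(\<lambda>n. \<Psi> (real (Suc n))) \<longlonglongrightarrow> 0"
        by (intro LIMSEQ_Suc filterlim_compose[OF Psi_at_top filterlim_real_sequentially])
      ultimately have "eventually (\<lambda>n. \<Psi> (real (Suc n)) < \<Psi> a - \<Psi> z) sequentially"
        by (intro order_tendstoD(2))
      then show ?thesis
      proof eventually_elim
        case (elim n)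
        then have "\<Psi> (u n) < \<Psi> a" using u(2)[of n] by simp
        then show ?case using Psi_less_iff[OF True u(1)] by simp
      qed
    next
      case False
      then show ?thesis using u(1) by (intro always_eventually allI) (meson not_less le_less_trans)
    qed
  next
    fix a assume a: "z < a"
    show "eventually (\<lambda>n. u n < a) sequentially"
    proof (intro always_eventually allI)
      fix n
      have "\<Psi> z < \<Psi> (u n)" using u(2)[of n] Psi_pos[of "real (Suc n)"] by simp
      then have "u n < z" using Psi_less_iff[OF u(1) z] by simp
      then show "u n < a" using a by simp
    qed
  qed
  have "(\<lambda>n. exp (- x * u n)) \<longlonglongrightarrow> exp (- x * z)" by (intro tendsto_intros u_lim)
  with L show ?thesis by (rule LIMSEQ_unique)
qed

lemma prob_survives:
  assumes x: "0 < x" and z: "0 < z"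
  shows "measure (P x) {\<omega> \<in> space (P x). 0 < X (\<Psi> z) \<omega>} = 1 - exp (- x * z)"
proof -
  interpret prob_space "P x" using x by (rule prob_space_P)
  have t: "0 \<le> \<Psi> z" using Psi_pos[OF z] by simp
  have "{\<omega> \<in> space M. X (\<Psi> z) \<omega> \<in> {0}} \<in> events"
    using sets_X[OF t, of "{0}"] sets_P[OF x] by simp
  then have "prob (space (P x) - {\<omega> \<in> space M. X (\<Psi> z) \<omega> \<in> {0}}) = 1 - exp (- x * z)"
    by (subst prob_compl) (simp_all only: prob_extinct[OF x z])
  also have "space (P x) - {\<omega> \<in> space M. X (\<Psi> z) \<omega> \<in> {0}} = {\<omega> \<in> space (P x). 0 < X (\<Psi> z) \<omega>}"
    using nonneg[OF t] space_P[OF x] by (auto simp: less_le)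
  finally show ?thesis .
qed

text \<open>The event defined by the extinction time differs from a measurable one by a null set,
  which makes it measurable for the completion.\<close>

lemma survival_event:
  assumes x: "0 < x" and t: "0 \<le> t"
  shows "AE \<omega> in completion (P x). ennreal t < extinction_time X \<omega> \<longleftrightarrow> 0 < X t \<omega>"
    and "{\<omega> \<in> space (P x). 0 < X t \<omega>} \<in> sets (P x)"
    and "{\<omega> \<in> space (completion (P x)). ennreal t < extinction_time X \<omega>} \<in> sets (completion (P x))"
proof -
  note [measurable] = measurable_X_P[OF x t]
  show AE: "AE \<omega> in completion (P x). ennreal t < extinction_time X \<omega> \<longleftrightarrow> 0 < X t \<omega>"
    by (rule AE_completion[OF AE_extinction_time[OF x t]])
  show Q: "{\<omega> \<in> space (P x). 0 < X t \<omega>} \<in> sets (P x)" by measurable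
  show "{\<omega> \<in> space (completion (P x)). ennreal t < extinction_time X \<omega>} \<in> sets (completion (P x))"
  proof (rule completion.in_sets_AE)
    show "AE \<omega> in completion (P x). \<omega> \<in> {\<omega> \<in> space (P x). 0 < X t \<omega>}
        \<longleftrightarrow> \<omega> \<in> {\<omega> \<in> space (completion (P x)). ennreal t < extinction_time X \<omega>}"
      using AE by eventually_elim auto
    show "{\<omega> \<in> space (P x). 0 < X t \<omega>} \<in> sets (completion (P x))" using Q by simp
  qed auto
qed

lemma cond_prob_survives:
  assumes x: "0 < x" and t: "0 \<le> t" and R: "{\<omega> \<in> space (P x). R \<omega>} \<in> sets (P x)"
  shows "\<P>(\<omega> in completion (P x). R \<omega> \<bar> ennreal t < extinction_time X \<omega>)
    = \<P>(\<omega> in P x. R \<omega> \<bar> 0 < X t \<omega>)"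
proof -
  interpret C: prob_space "completion (P x)" by (rule prob_space.prob_space_completion[OF prob_space_P[OF x]])
  note ev = survival_event[OF x t]
  have "\<P>(\<omega> in completion (P x). R \<omega> \<bar> ennreal t < extinction_time X \<omega>)
      = \<P>(\<omega> in completion (P x). R \<omega> \<bar> 0 < X t \<omega>)"
    by (rule C.cond_prob_eq_AE) (use ev R in auto)
  also have "\<dots> = \<P>(\<omega> in P x. R \<omega> \<bar> 0 < X t \<omega>)"
  proof -
    have "{\<omega> \<in> space (P x). R \<omega> \<and> 0 < X t \<omega>}
        = {\<omega> \<in> space (P x). R \<omega>} \<inter> {\<omega> \<in> space (P x). 0 < X t \<omega>}" by auto
    also have "\<dots> \<in> sets (P x)" by (rule sets.Int[OF R ev(2)])
    finally show ?thesis using ev(2) by (simp add: cond_prob_def)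
  qed
  finally show ?thesis .
qed

lemma survival_Psi:
  assumes z: "0 < z"
  shows "survival P X (\<Psi> z) = 1 - exp (- z)"
proof -
  interpret C: prob_space "completion (P 1)"
    by (rule prob_space.prob_space_completion[OF prob_space_P[OF zero_less_one]])
  have t: "0 \<le> \<Psi> z" using Psi_pos[OF z] by simp
  note ev = survival_event[OF zero_less_one t]
  have "survival P X (\<Psi> z) = \<P>(\<omega> in completion (P 1). 0 < X (\<Psi> z) \<omega>)"
    unfolding survival_def by (rule C.prob_eq_AE) (use ev in auto)
  also have "\<dots> = 1 - exp (- z)" using ev(2) prob_survives[OF zero_less_one z] by simp
  finally show ?thesis .
qed

text \<open>The factor \<open>1 - exp (- z)\<close> is the survival probability at time
  \<open>\<Psi> z\<close>. Conditioning on \<open>X (\<Psi> z) > 0\<close> keeps the law on the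
  uncompleted space.\<close>

definition cond_law :: "real \<Rightarrow> real \<Rightarrow> real measure" where
  "cond_law x z = distr (uniform_measure (P x) {\<omega> \<in> space (P x). 0 < X (\<Psi> z) \<omega>}) borel
     (\<lambda>\<omega>. (1 - exp (- z)) * X (\<Psi> z) \<omega>)"

text \<open>The law lives on the nonnegative half-line, so \<open>max y 0\<close> does not alter the
  Laplace transform there; it makes the test function bounded and continuous on the whole line, as
  weak convergence requires.\<close>

lemma
  assumes x: "0 < x" and z: "0 < z"
  shows real_distribution_cond_law: "real_distribution (cond_law x z)"
    and cdf_cond_law: "cdf (cond_law x z) y = conditional_df P X x (\<Psi> z) y"
    and laplace_cond_law: "0 < l \<Longrightarrow> \<exists>u>0. \<Psi> u = \<Psi> z + \<Psi> (l * (1 - exp (- z))) \<and>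
      1 - (\<integral>y. exp (- l * max y 0) \<partial>cond_law x z) = (1 - exp (- x * u)) / (1 - exp (- x * z))"
proof -
  interpret prob_space "P x" using x by (rule prob_space_P)
  have t: "0 \<le> \<Psi> z" using Psi_pos[OF z] by simp
  note [measurable] = measurable_X_P[OF x t]
  let ?q = "1 - exp (- z)" and ?A = "{\<omega> \<in> space (P x). 0 < X (\<Psi> z) \<omega>}"
  have q: "0 < ?q" using z by simp
  have X0: "0 \<le> X (\<Psi> z) \<omega>" if "\<omega> \<in> space (P x)" for \<omega> using nonneg[OF t] that space_P[OF x] by simp
  have A: "?A \<in> events" by measurable
  have prob_A: "prob ?A = 1 - exp (- x * z)" by (rule prob_survives[OF x z])
  have pos: "0 < 1 - exp (- x * z)" using x z by simp
  have emeasure_A: "emeasure (P x) ?A = ennreal (1 - exp (- x * z))"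
    by (simp only: emeasure_eq_measure prob_A)
  have nz: "emeasure (P x) ?A \<noteq> 0" "emeasure (P x) ?A \<noteq> \<infinity>"
    unfolding emeasure_A using pos by (simp_all add: ennreal_eq_0_iff)
  let ?U = "uniform_measure (P x) ?A"
  have U: "prob_space ?U" using nz by (rule prob_space_uniform_measure)
  have Y: "(\<lambda>\<omega>. ?q * X (\<Psi> z) \<omega>) \<in> borel_measurable ?U" by measurable
  show "real_distribution (cond_law x z)"
    unfolding cond_law_def by (rule prob_space.real_distribution_distr[OF U Y])
  show "cdf (cond_law x z) y = conditional_df P X x (\<Psi> z) y"
  proof -
    have "cdf (cond_law x z) y = measure ?U {\<omega> \<in> space (P x). ?q * X (\<Psi> z) \<omega> \<le> y}"
      unfolding cdf_def2 cond_law_def by (subst measure_distr[OF Y]) (auto intro!: arg_cong[where f = "measure ?U"])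
    also have "\<dots> = \<P>(\<omega> in P x. ?q * X (\<Psi> z) \<omega> \<le> y \<bar> 0 < X (\<Psi> z) \<omega>)"
      using measure_uniform_measure_eq_cond_prob[of "\<lambda>\<omega>. ?q * X (\<Psi> z) \<omega> \<le> y" "\<lambda>\<omega>. 0 < X (\<Psi> z) \<omega>"]
      by simp
    also have "\<dots> = conditional_df P X x (\<Psi> z) y"
      unfolding conditional_df_def survival_Psi[OF z]
      by (rule cond_prob_survives[OF x t, symmetric]) measurable
    finally show ?thesis .
  qed
  show "\<exists>u>0. \<Psi> u = \<Psi> z + \<Psi> (l * ?q) \<and>
      1 - (\<integral>y. exp (- l * max y 0) \<partial>cond_law x z) = (1 - exp (- x * u)) / (1 - exp (- x * z))"
    if l: "0 < l"
  proof -
    have lq: "0 < l * ?q" using l q by simp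
    obtain u where u: "0 < u" "\<Psi> u = \<Psi> z + \<Psi> (l * ?q)"
      and L: "(\<integral>\<omega>. exp (- (l * ?q) * X (\<Psi> z) \<omega>) \<partial>P x) = exp (- x * u)"
      using laplace_Psi[OF t lq] x by metis
    let ?f = "\<lambda>\<omega>. exp (- (l * ?q) * X (\<Psi> z) \<omega>)"
    have int: "integrable (P x) ?f"
      by (rule integrable_const_bound[of _ 1]) (use X0 lq in \<open>auto simp: mult_le_0_iff intro!: AE_I2\<close>)
    have intA: "integrable (P x) (\<lambda>\<omega>. ?f \<omega> * indicator ?A \<omega>)"
      by (rule integrable_real_mult_indicator[OF A int])
    \<comment> \<open>Off the survival event the exponential equals 1, so restricting the integral
      to that event subtracts the extinction probability \<open>exp (- x * z)\<close>.\<close>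
    have split: "(\<integral>\<omega>. ?f \<omega> * indicator ?A \<omega> \<partial>P x) = exp (- x * u) - exp (- x * z)"
    proof -
      have "(\<integral>\<omega>. ?f \<omega> * indicator ?A \<omega> \<partial>P x) = (\<integral>\<omega>. ?f \<omega> - (1 - indicator ?A \<omega>) \<partial>P x)"
      proof (rule Bochner_Integration.integral_cong[OF refl])
        fix \<omega> assume "\<omega> \<in> space (P x)"
        then show "?f \<omega> * indicator ?A \<omega> = ?f \<omega> - (1 - indicator ?A \<omega>)"
          using X0[of \<omega>] by (cases "X (\<Psi> z) \<omega> = 0") (auto simp: indicator_def)
      qed
      also have "\<dots> = exp (- x * u) - (1 - prob ?A)"
      proof -
        have "integrable (P x) (indicator ?A :: _ \<Rightarrow> real)"
          using A by (simp add: integrable_indicator_iff emeasure_eq_measure)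
        then show ?thesis using int A L by (simp add: prob_space del: mult_minus_left)
      qed
      finally show ?thesis by (simp add: prob_A)
    qed
    have "(\<integral>y. exp (- l * max y 0) \<partial>cond_law x z) = (\<integral>\<omega>. exp (- l * max (?q * X (\<Psi> z) \<omega>) 0) \<partial>?U)"
      unfolding cond_law_def by (rule integral_distr[OF Y]) measurable
    also have "\<dots> = (\<integral>\<omega>. ?f \<omega> \<partial>?U)"
    proof (rule Bochner_Integration.integral_cong[OF refl])
      fix \<omega> assume "\<omega> \<in> space ?U"
      then have "0 \<le> ?q * X (\<Psi> z) \<omega>" using X0[of \<omega>] q by (intro mult_nonneg_nonneg) simp_all
      then show "exp (- l * max (?q * X (\<Psi> z) \<omega>) 0) = ?f \<omega>"
        by (simp only: max_absorb1 mult.assoc mult_minus_left)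
    qed
    also have "\<dots> = enn2real (\<integral>\<^sup>+\<omega>. ennreal (?f \<omega>) \<partial>?U)"
      by (rule integral_eq_nn_integral) simp_all
    also have "(\<integral>\<^sup>+\<omega>. ennreal (?f \<omega>) \<partial>?U) =
        (\<integral>\<^sup>+\<omega>. ennreal (?f \<omega>) * indicator ?A \<omega> \<partial>P x) / emeasure (P x) ?A"
      by (rule nn_integral_uniform_measure) (use A in simp_all)
    also have "(\<integral>\<^sup>+\<omega>. ennreal (?f \<omega>) * indicator ?A \<omega> \<partial>P x)
        = (\<integral>\<^sup>+\<omega>. ennreal (?f \<omega> * indicator ?A \<omega>) \<partial>P x)"
      by (rule nn_integral_cong) (simp add: indicator_def)
    also have "\<dots> = ennreal (exp (- x * u) - exp (- x * z))"
      unfolding split[symmetric] by (rule nn_integral_eq_integral[OF intA]) simp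
    also have "enn2real (ennreal (exp (- x * u) - exp (- x * z)) / emeasure (P x) ?A)
        = (exp (- x * u) - exp (- x * z)) / (1 - exp (- x * z))"
    proof -
      have "0 \<le> exp (- x * u) - exp (- x * z)" unfolding split[symmetric] by simp
      then show ?thesis unfolding emeasure_A using pos by (simp add: divide_ennreal)
    qed
    finally have "1 - (\<integral>y. exp (- l * max y 0) \<partial>cond_law x z)
        = 1 - (exp (- x * u) - exp (- x * z)) / (1 - exp (- x * z))" by simp
    also have "\<dots> = (1 - exp (- x * u)) / (1 - exp (- x * z))"
    proof -
      have "1 - (a - b) / (1 - b) = (1 - a) / (1 - b)" if "0 < 1 - b" for a b :: real
        using that by (simp add: divide_simps)
      from this[OF pos] show ?thesis .
    qed
    finally show ?thesis using u by blast
  qed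
qed

text \<open>The cumulant started at 1 stays positive at all times, so \<open>\<Psi>\<close> takes
  arbitrarily large values. Hence times tending to infinity correspond to \<open>z\<close> tending
  to 0.\<close>

lemma Psi_at_right_0: "filterlim \<Psi> at_top (at_right 0)"
  unfolding filterlim_at_top
proof
  fix C :: real
  obtain u where u: "0 < u" "\<Psi> u = max C 0 + \<Psi> 1"
    using laplace_Psi[of "max C 0" 1] by auto
  have "eventually (\<lambda>z. z \<in> {0<..<u}) (at_right 0)"
    by (rule eventually_at_rightI[OF _ u(1)])
  then show "eventually (\<lambda>z. C \<le> \<Psi> z) (at_right 0)"
  proof eventually_elim
    case (elim z)
    then have "\<Psi> u < \<Psi> z" by (intro Psi_strict_antimono) auto
    then show ?case using u(2) Psi_pos[of 1] by simp
  qed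
qed

text \<open>Weak convergence of measures is formulated for sequences, so the limit at 0 is tested
  along sequences \<open>Z\<close> and the hypothesis is used at the times
  \<open>\<Psi> (Z n)\<close>.\<close>

lemma laplace_cond_law_tendsto:
  assumes x: "0 < x" and \<nu>: "real_distribution \<nu>"
    and conv: "weak_conv_at_top (conditional_df P X x) (cdf \<nu>)" and l: "0 < l"
  shows "((\<lambda>z. \<integral>y. exp (- l * max y 0) \<partial>cond_law x z) \<longlongrightarrow> (\<integral>y. exp (- l * max y 0) \<partial>\<nu>)) (at_right 0)"
  unfolding tendsto_at_iff_sequentially
proof (intro allI impI)
  fix Z :: "nat \<Rightarrow> real" assume Z: "\<forall>i. Z i \<in> {0<..} - {0}" "Z \<longlonglongrightarrow> 0"
  have Zpos: "0 < Z i" for i using Z(1) by auto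
  have "filterlim Z (at_right 0) sequentially"
    by (rule filterlim_at_withinI[OF Z(2)]) (use Z(1) in auto)
  then have Zt: "filterlim (\<lambda>n. \<Psi> (Z n)) at_top sequentially"
    by (rule filterlim_compose[OF Psi_at_right_0])
  have "weak_conv_m (\<lambda>n. cond_law x (Z n)) \<nu>"
    unfolding weak_conv_m_def weak_conv_def cdf_cond_law[OF x Zpos]
  proof (intro allI impI)
    fix y assume "isCont (cdf \<nu>) y"
    with conv have "((\<lambda>t. conditional_df P X x t y) \<longlongrightarrow> cdf \<nu> y) at_top"
      unfolding weak_conv_at_top_def by simp
    from filterlim_compose[OF this Zt]
    show "(\<lambda>n. conditional_df P X x (\<Psi> (Z n)) y) \<longlonglongrightarrow> cdf \<nu> y" .
  qed
  then have "(\<lambda>n. \<integral>y. exp (- l * max y 0) \<partial>cond_law x (Z n)) \<longlonglongrightarrow> (\<integral>y. exp (- l * max y 0) \<partial>\<nu>)"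
  proof (rule weak_conv_imp_integral_bdd_continuous_conv[OF real_distribution_cond_law[OF x Zpos] \<nu>])
    show "isCont (\<lambda>y. exp (- l * max y 0)) y" for y by (intro continuous_intros)
    show "norm (exp (- l * max y 0)) \<le> 1" for y using l by (simp add: mult_nonneg_nonneg)
  qed
  then show "((\<lambda>z. \<integral>y. exp (- l * max y 0) \<partial>cond_law x z) \<circ> Z) \<longlonglongrightarrow> (\<integral>y. exp (- l * max y 0) \<partial>\<nu>)"
    by (simp add: o_def)
qed

text \<open>In the scaled variables the composition rule \<open>\<Psi> (u t l) = t + \<Psi> l\<close> reads
  \<open>\<Psi> (g l z) \<sim> \<Psi> z + \<Psi> (l z)\<close> as \<open>z \<rightarrow> 0\<close>, where \<open>1 - g\<close> is the Laplace transform of the limit law.\<close>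

lemma F_step:
  assumes x: "0 < x" and \<nu>: "real_distribution \<nu>"
    and conv: "weak_conv_at_top (conditional_df P X x) (cdf \<nu>)" and l: "0 < l"
    and g: "g = 1 - (\<integral>y. exp (- l * max y 0) \<partial>\<nu>)" "0 < g"
  shows "((\<lambda>z. F g z - F l z) \<longlongrightarrow> 1) (at_right 0)"
proof -
  have "\<forall>z. \<exists>u. 0 < z \<longrightarrow> 0 < u \<and> \<Psi> u = \<Psi> z + \<Psi> (l * (1 - exp (- z))) \<and>
      1 - (\<integral>y. exp (- l * max y 0) \<partial>cond_law x z) = (1 - exp (- x * u)) / (1 - exp (- x * z))"
    using laplace_cond_law[OF x _ l] by blast
  then obtain U where U: "\<And>z. 0 < z \<Longrightarrow> 0 < U z"
    "\<And>z. 0 < z \<Longrightarrow> \<Psi> (U z) = \<Psi> z + \<Psi> (l * (1 - exp (- z)))"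
    "\<And>z. 0 < z \<Longrightarrow> 1 - (\<integral>y. exp (- l * max y 0) \<partial>cond_law x z)
      = (1 - exp (- x * U z)) / (1 - exp (- x * z))" by metis
  note ev = eventually_at_right_less[of "0 :: real"]
  have U_less: "U z < z" if z: "0 < z" for z
  proof -
    have "0 < \<Psi> (l * (1 - exp (- z)))" using l z by (intro Psi_pos) simp
    then have "\<Psi> z < \<Psi> (U z)" using U(2)[OF z] by simp
    then show ?thesis using Psi_less_iff[OF U(1)[OF z] z] by simp
  qed
  \<comment> \<open>\<open>e\<close> linearises the exponentials:
    \<open>1 - exp (- s) = s * e s\<close> with \<open>e s\<close> tending to 1 at 0.\<close>
  define e where "e s = (1 - exp (- s)) / s" for s :: real
  have e: "(e \<longlongrightarrow> 1) (at_right 0)"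
  proof -
    have "((\<lambda>s::real. - exp (- s)) has_real_derivative 1) (at 0)"
      by (auto intro!: derivative_eq_intros)
    then have "(e \<longlongrightarrow> 1) (at 0)" by (simp add: DERIV_def e_def[abs_def])
    then show ?thesis by (rule filterlim_mono[OF _ order_refl at_le]) simp
  qed
  have e_pos: "0 < e s" if "0 < s" for s using that by (simp add: e_def)
  have U_lim: "filterlim U (at_right 0) (at_right 0)"
  proof (rule filterlim_at_withinI)
    show "(U \<longlongrightarrow> 0) (at_right 0)"
    proof (rule tendsto_sandwich[OF _ _ tendsto_const tendsto_ident_at])
      show "eventually (\<lambda>z. 0 \<le> U z) (at_right 0)" using ev by eventually_elim (use U(1) in force)
      show "eventually (\<lambda>z. U z \<le> z) (at_right 0)" using ev by eventually_elim (use U_less in force)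
    qed
    show "eventually (\<lambda>z. U z \<in> {0<..} - {0}) (at_right 0)"
      using ev by eventually_elim (use U(1) in force)
  qed
  have quot: "((\<lambda>z. (1 - exp (- x * U z)) / (1 - exp (- x * z))) \<longlongrightarrow> g) (at_right 0)"
    unfolding g(1)
    by (rule Lim_transform_eventually[OF tendsto_diff[OF tendsto_const laplace_cond_law_tendsto[OF x \<nu> conv l]]])
      (use ev in eventually_elim, simp only: U(3))
  \<comment> \<open>The correction by \<open>e\<close> reduces the quotient to
    \<open>U z / z\<close>; the starting point \<open>x\<close> cancels. It needs \<open>U z\<close>
    to tend to 0, which holds because \<open>U z < z\<close>.\<close>
  have "((\<lambda>z. (1 - exp (- x * U z)) / (1 - exp (- x * z)) * e (x * z) / e (x * U z)) \<longlongrightarrow> g * 1 / 1) (at_right 0)"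
    by (intro tendsto_mult tendsto_divide quot filterlim_compose[OF e]
        filterlim_compose[OF filterlim_mult_at_right_0[OF x] U_lim] filterlim_mult_at_right_0[OF x]) simp
  then have "((\<lambda>z. (1 - exp (- x * U z)) / (1 - exp (- x * z)) * e (x * z) / e (x * U z)) \<longlongrightarrow> g) (at_right 0)"
    by simp
  then have w: "((\<lambda>z. U z / z) \<longlongrightarrow> g) (at_right 0)"
  proof (rule Lim_transform_eventually)
    show "eventually (\<lambda>z. (1 - exp (- x * U z)) / (1 - exp (- x * z)) * e (x * z) / e (x * U z) = U z / z) (at_right 0)"
      using ev
    proof eventually_elim
      case (elim z)
      have "exp (- (x * z)) \<noteq> 1" "exp (- (x * U z)) \<noteq> 1" "U z \<noteq> 0" using elim U(1)[OF elim] x by auto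
      then show ?case using elim x by (simp add: e_def)
    qed
  qed
  have k: "((\<lambda>z. l * e z) \<longlongrightarrow> l) (at_right 0)"
    using tendsto_mult[OF tendsto_const e, of l] by simp
  have Fg: "((\<lambda>z. \<Psi> (U z / z * z) / \<Psi> (g * z)) \<longlongrightarrow> 1) (at_right 0)"
    by (rule Psi_asymp_equiv[OF g(2) w])
  have Fl: "((\<lambda>z. \<Psi> (l * e z * z) / \<Psi> (l * z)) \<longlongrightarrow> 1) (at_right 0)"
    by (rule Psi_asymp_equiv[OF l k])
  \<comment> \<open>Neither \<open>F g\<close> nor \<open>F l\<close> is known to converge at this
    point; boundedness is what turns the vanishing relative errors into vanishing absolute
    ones.\<close>
  have F_bdd: "Bfun (F c) (at_right 0)" if c: "0 < c" for c
  proof (rule BfunI)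
    show "eventually (\<lambda>z. norm (F c z) \<le> max 1 (1 / c)) (at_right 0)"
      using ev
    proof eventually_elim
      case (elim z)
      show ?case using F_bounds(2)[OF c elim] F_pos[OF c elim] by simp
    qed
  qed
  have "((\<lambda>z. (\<Psi> (U z / z * z) / \<Psi> (g * z) - 1) * F g z) \<longlongrightarrow> 0) (at_right 0)"
    using bounded_bilinear.Zfun_prod_Bfun[OF bounded_bilinear_mult iffD1[OF tendsto_Zfun_iff Fg] F_bdd[OF g(2)]] by (simp add: tendsto_Zfun_iff)
  moreover have "((\<lambda>z. (\<Psi> (l * e z * z) / \<Psi> (l * z) - 1) * F l z) \<longlongrightarrow> 0) (at_right 0)"
    using bounded_bilinear.Zfun_prod_Bfun[OF bounded_bilinear_mult iffD1[OF tendsto_Zfun_iff Fl] F_bdd[OF l]] by (simp add: tendsto_Zfun_iff)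
  ultimately have "((\<lambda>z. 1 + ((\<Psi> (l * e z * z) / \<Psi> (l * z) - 1) * F l z)
      - (\<Psi> (U z / z * z) / \<Psi> (g * z) - 1) * F g z) \<longlongrightarrow> 1 + 0 - 0) (at_right 0)"
    by (intro tendsto_add tendsto_diff tendsto_const)
  then have lim: "((\<lambda>z. 1 + ((\<Psi> (l * e z * z) / \<Psi> (l * z) - 1) * F l z)
      - (\<Psi> (U z / z * z) / \<Psi> (g * z) - 1) * F g z) \<longlongrightarrow> 1) (at_right 0)" by simp
  show ?thesis
  proof (rule Lim_transform_eventually[OF lim])
    show "eventually (\<lambda>z. 1 + ((\<Psi> (l * e z * z) / \<Psi> (l * z) - 1) * F l z)
        - (\<Psi> (U z / z * z) / \<Psi> (g * z) - 1) * F g z = F g z - F l z) (at_right 0)"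
      using ev
    proof eventually_elim
      case (elim z)
      have nz: "\<Psi> z \<noteq> 0" "\<Psi> (l * z) \<noteq> 0" "\<Psi> (g * z) \<noteq> 0"
        using Psi_pos[of z] Psi_pos[of "l * z"] Psi_pos[of "g * z"] elim l g(2) by auto
      \<comment> \<open>By the composition rule both products contain
        \<open>\<Psi> (U z) / \<Psi> z\<close>, which cancels; the term
        \<open>\<Psi> z / \<Psi> z\<close> cancels the leading 1.\<close>
      have "l * e z * z = l * (1 - exp (- z))" using elim by (simp add: e_def)
      then have "\<Psi> (l * e z * z) = \<Psi> (U z) - \<Psi> z" using U(2)[OF elim] by (simp only:)
      then have 1: "(\<Psi> (l * e z * z) / \<Psi> (l * z) - 1) * F l z = (\<Psi> (U z) - \<Psi> z) / \<Psi> z - F l z"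
        using nz by (simp only:) (simp add: F_def field_simps)
      have 2: "(\<Psi> (U z / z * z) / \<Psi> (g * z) - 1) * F g z = \<Psi> (U z) / \<Psi> z - F g z"
        using elim nz by (simp add: F_def field_simps)
      show ?case unfolding 1 2 using nz by (simp add: field_simps)
    qed
  qed
qed

end

text \<open>The limit law puts mass on \<open>(0, \<infinity>)\<close>, because the point mass at \<open>0\<close> is degenerate.\<close>

lemma laplace_less_1:
  assumes \<nu>: "real_distribution \<nu>" and nondeg: "\<nexists>c. cdf \<nu> = cdf (return borel c)"
    and neg: "\<forall>y<0. cdf \<nu> y = 0" and l: "0 < l"
  shows "(\<integral>y. exp (- l * max y 0) \<partial>\<nu>) < 1"
proof -
  interpret \<nu>: real_distribution \<nu> by (rule \<nu>)
  have int: "integrable \<nu> (\<lambda>y. exp (- l * max y 0))"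
    by (rule \<nu>.integrable_const_bound[of _ 1]) (use l in \<open>auto simp: mult_nonneg_nonneg intro!: AE_I2\<close>)
  have nonneg: "0 \<le> 1 - exp (- l * max y 0)" for y using l by (simp add: mult_nonneg_nonneg)
  have eq: "(\<integral>y. 1 - exp (- l * max y 0) \<partial>\<nu>) = 1 - (\<integral>y. exp (- l * max y 0) \<partial>\<nu>)"
    using int \<nu>.prob_space by (simp del: mult_minus_left)
  have "0 \<le> (\<integral>y. 1 - exp (- l * max y 0) \<partial>\<nu>)" by (intro integral_nonneg_AE AE_I2 nonneg)
  moreover have "(\<integral>y. 1 - exp (- l * max y 0) \<partial>\<nu>) \<noteq> 0"
  proof
    assume "(\<integral>y. 1 - exp (- l * max y 0) \<partial>\<nu>) = 0"
    then have "AE y in \<nu>. 1 - exp (- l * max y 0) = 0"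
      by (subst (asm) integral_nonneg_eq_0_iff_AE)
        (use int nonneg in \<open>auto intro!: Bochner_Integration.integrable_diff AE_I2\<close>)
    then have AE0: "AE y in \<nu>. y \<le> 0"
      by eventually_elim (use l in \<open>auto simp: max_def split: if_splits\<close>)
    \<comment> \<open>The integral with \<open>max y 0\<close> cannot see mass on the negative
      half-line; \<open>neg\<close> excludes such mass.\<close>
    have "cdf \<nu> y = cdf (return borel 0) y" for y
    proof (cases "y < 0")
      case True
      then show ?thesis using neg by (simp add: cdf_def2 measure_return)
    next
      case False
      have "AE x in \<nu>. x \<in> {..y}" using AE0 by eventually_elim (use False in simp)
      then have "cdf \<nu> y = 1" unfolding cdf_def2 by (intro \<nu>.prob_eq_1[THEN iffD2]) auto
      then show ?thesis using False by (simp add: cdf_def2 measure_return)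
    qed
    then show False using nondeg by blast
  qed
  ultimately show ?thesis using eq by simp
qed

theorem theorem2:
  fixes M :: "'w measure" and P :: "real \<Rightarrow> 'w measure" and X :: "real \<Rightarrow> 'w \<Rightarrow> real"
    and \<psi> H :: "real \<Rightarrow> real" and x :: real
  assumes "cb_process M P X \<psi>"
    and "critical \<psi>"
    and "grey_condition \<psi>"
    and "0 < x"
    and "nondegenerate_df H"
    and "\<forall>y<0. H y = 0"
    and "weak_conv_at_top (conditional_df P X x) H"
  shows "\<exists>\<alpha> L. 0 < \<alpha> \<and> \<alpha> \<le> 1 \<and> slowly_varying L \<and>
           (\<forall>l>0. \<psi> l = l powr (1 + \<alpha>) * L (1 / l))"
proof -
  have "mechanism_shape \<psi>"
    using cb_process.mechanism[OF assms(1)] assms(2,3) by (rule branching_mechanism_shape)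
  then obtain \<Psi> where \<Psi>: "grey_function \<psi> \<Psi>"
    using assms(3) by (rule mechanism_shape.grey_function_exists)
  interpret extinction_cb M P X \<psi> \<Psi>
    by (rule extinction_cb.intro[OF assms(1) \<Psi>])
  obtain \<nu> where \<nu>: "real_distribution \<nu>" and H: "H = cdf \<nu>"
    and nondeg: "\<nexists>c. cdf \<nu> = cdf (return borel c)"
    using assms(5) unfolding nondegenerate_df_def prob_df_def by blast
  define g where "g l = 1 - (\<integral>y. exp (- l * max y 0) \<partial>\<nu>)" for l
  \<comment> \<open>Non-degeneracy enters here: \<open>g\<close> must send positive scales to
    positive scales, since \<open>\<Psi>\<close> is controlled only there and \<open>g\<close> is
    iterated.\<close>
  have g_pos: "0 < g l" if "0 < l" for l
    using laplace_less_1[OF \<nu> nondeg assms(6)[unfolded H] that] by (simp add: g_def)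
  have step: "((\<lambda>z. F (g l) z - F l z) \<longlongrightarrow> 1) (at_right 0)" if "0 < l" for l
    by (rule F_step[OF assms(4) \<nu> assms(7)[unfolded H] that _ g_pos[OF that]]) (simp add: g_def)
  obtain \<alpha> where \<alpha>: "0 < \<alpha>" "\<alpha> \<le> 1"
    and lim: "\<And>c. 0 < c \<Longrightarrow> (F c \<longlongrightarrow> c powr - \<alpha>) (at_right 0)"
  proof (rule F_regular[of g])
    show "0 < g l" if "0 < l" for l by (rule g_pos[OF that])
    show "((\<lambda>z. F (g l) z - F l z) \<longlongrightarrow> 1) (at_right 0)" if "0 < l" for l by (rule step[OF that])
  qed (rule that)
  have "\<exists>L. slowly_varying L \<and> (\<forall>l>0. \<psi> l = l powr (1 + \<alpha>) * L (1 / l))"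
    by (rule slowly_varying_repr[OF psi_regular[OF \<alpha>(1) lim]])
  with \<alpha> show ?thesis by blast
qed

end
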